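(* Assume $\pi_N(X)\equiv\bar\pi_N$ (labels missing completely at random), $N\bar\pi_N\to\infty$ as $N\to\infty$, $\|m(\cdot)-\mu(\cdot)\|_{2,\mathbb P}<\infty$ and $\|\hat m(\cdot)-\mu(\cdot)\|_{2,\mathbb P}=o_p(1)$ (for each cross-fitted $\hat m(\cdot;\mathbb S_{-k})$). Let $\hat\pi_N(X_i)=N_{-k}^{-1}\sum_{j\notin\mathcal I_k}R_j$ for $i\in\mathcal I_k$, where $N_{-k}=|\{1,\dots,N\}\setminus\mathcal I_k|$. Then $a_N=\bar\pi_N$ and $$\mathbb E_X\Big[\frac{a_N}{\pi_N(X)}\Big\{1-\frac{\pi_N(X)}{\hat\pi_N(X)}\Big\}^2\Big]=\mathbb E_X\Big\{1-\frac{\pi_N(X)}{\hat\pi_N(X)}\Big\}^2=O_p\big((N\bar\pi_N)^{-1}\big).$$ Furthermore, $$\hat\theta_{\mathrm{DRSS}}-\theta_0=N^{-1}\sum_{i=1}^N\Psi(Z_i)+o_p\big((Na_N)^{-1/2}\big),\qquad\Psi(Z)=\psi_\mu(Z)+\mathrm{IF}_\pi(Z),$$ $$\psi_\mu(Z)=\frac{R}{\bar\pi_N}\{Y-\mu(X)\}+\mu(X)-\theta_0,\qquad \mathrm{IF}_\pi(Z)=\Big(\frac{R-\bar\pi_N}{\bar\pi_N}\Big)\Delta_\mu,\qquad\Delta_\mu=\mathbb E\{\mu(X)-m(X)\}.$$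
   Context: Setting. For each $N$ the data $\mathbb S=\{Z_i=(R_i,R_iY_i,X_i)\}_{i=1}^N$ are i.i.d. copies of $Z=(R,RY,X)$, $R\in\{0,1\}$, $Y\in\mathbb R$, $X\in\mathbb R^p$ with support $\mathcal X$; the law of $R$ may depend on $N$ (triangular array). Ignorability $R\perp\!\!\!\perp Y\mid X$ is assumed throughout. $\theta_0=\mathbb E(Y)$, $m(x)=\mathbb E(Y\mid X=x)$, $\pi_N(x)=\mathbb P(R=1\mid X=x)$, $\bar\pi_N=\mathbb P(R=1)$, $a_N=[\mathbb E\{\pi_N^{-1}(X)\}]^{-1}$. Cross-fitting. For a fixed integer $\mathbb K\ge2$, $\{\mathcal I_k\}_{k=1}^{\mathbb K}$ is a random partition of $\{1,\dots,N\}$ (independent of the data) into folds of equal size; $\mathbb S_{-k}=\{Z_i:i\notin\mathcal I_k\}$; $\hat m(\cdot;\mathbb S_{-k})$ is an estimator of $m$ built from $\mathbb S_{-k}$ and $\hat m(X_i)=\hat m(X_i;\mathbb S_{-k})$ for $i\in\mathcal I_k$. $\hat\theta_{\mathrm{DRSS}}=N^{-1}\sum_{i=1}^N\big[\hat m(X_i)+\frac{R_i}{\hat\pi_N(X_i)}\{Y_i-\hat m(X_i)\}\big]$. $\mu(\cdot)$ is a nonrandom function, possibly $\mu\neq m$. Basic Assumption (in force for the expansion of $\hat\theta_{\mathrm{DRSS}}$): $Z$ has finite second moments, $\mathrm{Var}(X)$ is positive definite, and there are constants $0<\sigma_{\zeta,1}^2,\sigma_{\zeta,2}^2<\infty$ not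 depending on $N$ with $\mathbb E[\{Y-m(X)\}^2\mid X=x]\ge\sigma_{\zeta,1}^2$, $\mathbb E[\{Y-\mu(X)\}^2\mid X=x]\le\sigma_{\zeta,2}^2$ for all $x\in\mathcal X$, and $\mathrm{Var}(Y)\le\sigma_{\zeta,2}^2$. $\mathbb E_X$ and the norms $\|f\|_{2,\mathbb P}=\{\mathbb E|f(X)|^2\}^{1/2}$ are taken over an independent copy of $X$ with estimators held fixed; the bound "$<\infty$" is uniform in $N$. *)

theory Defs
  imports "HOL-Probability.Probability"
begin

definition cond_E :: "'u measure \<Rightarrow> ('u \<Rightarrow> 'x::topological_space) \<Rightarrow> ('u \<Rightarrow> real) \<Rightarrow> 'u \<Rightarrow> real" where
  "cond_E P X V = real_cond_exp P (vimage_algebra (space P) X borel) V"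

text \<open>\<open>g\<close> is a version of the function \<open>x \<mapsto> E(V | X = x)\<close>.\<close>

definition is_regression ::
  "'u measure \<Rightarrow> ('u \<Rightarrow> 'x::topological_space) \<Rightarrow> ('u \<Rightarrow> real) \<Rightarrow> ('x \<Rightarrow> real) \<Rightarrow> bool" where
  "is_regression P X V g \<longleftrightarrow>
     g \<in> borel_measurable borel \<and> (AE u in P. g (X u) = cond_E P X V u)"

definition cond_indep ::
  "'u measure \<Rightarrow> ('u \<Rightarrow> real) \<Rightarrow> ('u \<Rightarrow> real) \<Rightarrow> ('u \<Rightarrow> 'x::topological_space) \<Rightarrow> bool" where
  "cond_indep P S V X \<longleftrightarrow> (\<forall>A\<in>sets borel. \<forall>B\<in>sets borel. AE u in P.
     cond_E P X (\<lambda>u. indicator A (S u) * indicator B (V u)) u =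
     cond_E P X (\<lambda>u. indicator A (S u)) u * cond_E P X (\<lambda>u. indicator B (V u)) u)"

definition cov_matrix :: "'u measure \<Rightarrow> ('u \<Rightarrow> real ^ 'p) \<Rightarrow> real ^ 'p ^ 'p" where
  "cov_matrix P X = (\<chi> i j. LINT u|P.
     (X u $ i - (LINT u|P. X u $ i)) * (X u $ j - (LINT u|P. X u $ j)))"

definition pos_definite :: "real ^ 'p ^ 'p \<Rightarrow> bool" where
  "pos_definite A \<longleftrightarrow> transpose A = A \<and> (\<forall>v. v \<noteq> 0 \<longrightarrow> 0 < v \<bullet> (A *v v))"

text \<open>The triangular array is modelled on one population space: \<open>Y\<close> and \<open>X\<close> are fixed and
  only the labelling indicator \<open>R N\<close> depends on the sample size \<open>N\<close>.\<close>

locale missing_data_population = prob_space P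
  for P :: "'u measure" +
  fixes R :: "nat \<Rightarrow> 'u \<Rightarrow> real" and Y :: "'u \<Rightarrow> real" and X :: "'u \<Rightarrow> real ^ 'p"
  assumes R_measurable: "R N \<in> borel_measurable P"
    and Y_measurable: "Y \<in> borel_measurable P"
    and X_measurable: "X \<in> borel_measurable P"
    and R_binary: "u \<in> space P \<Longrightarrow> R N u \<in> {0, 1}"
    and ignorability: "cond_indep P (R N) Y X"

text \<open>Pointwise conditions on the support of \<open>X\<close> are read almost everywhere, conditional
  expectations being determined only up to null sets. The integrability conditions on \<open>Y\<^sup>2\<close> and
  \<open>(Y - \<mu>(X))\<^sup>2\<close> express that the variance and the conditional second moment bounded below
  are finite (they would otherwise have junk values).\<close>

locale basic_assumption = missing_data_population P R Y X
  for P :: "'u measure" and R :: "nat \<Rightarrow> 'u \<Rightarrow> real" and Y :: "'u \<Rightarrow> real"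
    and X :: "'u \<Rightarrow> real ^ 'p" +
  fixes m \<mu> :: "real ^ 'p \<Rightarrow> real" and sigma1_sq sigma2_sq :: real
  assumes finite_second_moments:
      "integrable P (\<lambda>u. (norm (R N u, R N u * Y u, X u))\<^sup>2)"
    and var_X_pos_definite: "pos_definite (cov_matrix P X)"
    and sigma1_sq_pos: "0 < sigma1_sq" and sigma2_sq_pos: "0 < sigma2_sq"
    and cond_var_lower: "AE u in P. cond_E P X (\<lambda>u. (Y u - m (X u))\<^sup>2) u \<ge> sigma1_sq"
    and Y_mu_square_integrable: "integrable P (\<lambda>u. (Y u - \<mu> (X u))\<^sup>2)"
    and cond_second_moment_upper:
      "AE u in P. cond_E P X (\<lambda>u. (Y u - \<mu> (X u))\<^sup>2) u \<le> sigma2_sq"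
    and Y_square_integrable: "integrable P (\<lambda>u. (Y u)\<^sup>2)"
    and var_Y_upper: "variance Y \<le> sigma2_sq"

definition pi_bar :: "'u measure \<Rightarrow> (nat \<Rightarrow> 'u \<Rightarrow> real) \<Rightarrow> nat \<Rightarrow> real" where
  "pi_bar P R N = measure P {u \<in> space P. R N u = 1}"

definition is_propensity ::
  "'u measure \<Rightarrow> ('u \<Rightarrow> 'x::topological_space) \<Rightarrow> ('u \<Rightarrow> real) \<Rightarrow> ('x \<Rightarrow> real) \<Rightarrow> bool" where
  "is_propensity P X S p \<longleftrightarrow> is_regression P X (\<lambda>u. indicator {1} (S u)) p"

text \<open>Expectation of \<open>f(X)\<close> over an independent copy of \<open>X\<close>; data-dependent quantities
  occurring in \<open>f\<close> live on the sample space and are held fixed.\<close>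

definition E_X :: "'u measure \<Rightarrow> ('u \<Rightarrow> 'x) \<Rightarrow> ('x \<Rightarrow> real) \<Rightarrow> real" where
  "E_X P X f = (LINT u|P. f (X u))"

text \<open>Infinite, rather than the junk value \<open>0\<close>, when \<open>f(X)\<close> is not square integrable.\<close>

definition norm2 :: "'u measure \<Rightarrow> ('u \<Rightarrow> 'x) \<Rightarrow> ('x \<Rightarrow> real) \<Rightarrow> ereal" where
  "norm2 P X f =
     (if integrable P (\<lambda>u. (f (X u))\<^sup>2) then ereal (sqrt (LINT u|P. \<bar>f (X u)\<bar>\<^sup>2)) else \<infinity>)"

definition a_seq ::
  "'u measure \<Rightarrow> ('u \<Rightarrow> 'x) \<Rightarrow> (nat \<Rightarrow> 'x \<Rightarrow> real) \<Rightarrow> nat \<Rightarrow> real" where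
  "a_seq P X \<pi> N = inverse (E_X P X (\<lambda>x. inverse (\<pi> N x)))"

text \<open>Folds have equal size, so the sample sizes are the positive multiples of the number \<open>K\<close>
  of folds, and asymptotics are taken along these.\<close>

definition sample_sizes :: "nat \<Rightarrow> nat set" where
  "sample_sizes K = {N. 0 < N \<and> K dvd N}"

definition large_samples :: "nat \<Rightarrow> nat filter" where
  "large_samples K = inf at_top (principal (sample_sizes K))"

text \<open>\<open>M N\<close> is the probability space carrying the sample of size \<open>N\<close>. Measurability is part of
  the definitions since \<open>measure\<close> vanishes on non-measurable sets.\<close>

definition bigO_p ::
  "nat filter \<Rightarrow> (nat \<Rightarrow> 'w measure) \<Rightarrow> (nat \<Rightarrow> 'w \<Rightarrow> ereal) \<Rightarrow> (nat \<Rightarrow> real) \<Rightarrow> bool" where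
  "bigO_p F M V b \<longleftrightarrow>
     (\<forall>\<^sub>F N in F. V N \<in> borel_measurable (M N)) \<and>
     (\<forall>\<epsilon>>0. \<exists>C::real. \<forall>\<^sub>F N in F.
        measure (M N) {\<omega> \<in> space (M N). \<bar>V N \<omega>\<bar> > ereal (C * b N)} < \<epsilon>)"

definition smallo_p ::
  "nat filter \<Rightarrow> (nat \<Rightarrow> 'w measure) \<Rightarrow> (nat \<Rightarrow> 'w \<Rightarrow> ereal) \<Rightarrow> (nat \<Rightarrow> real) \<Rightarrow> bool" where
  "smallo_p F M V b \<longleftrightarrow>
     (\<forall>\<^sub>F N in F. V N \<in> borel_measurable (M N)) \<and>
     (\<forall>\<epsilon>>0. ((\<lambda>N. measure (M N) {\<omega> \<in> space (M N). \<bar>V N \<omega>\<bar> > ereal (\<epsilon> * b N)}) \<longlongrightarrow> 0) F)"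

type_synonym 'p obs = "real \<times> real \<times> (real ^ 'p)"

definition observe :: "real \<Rightarrow> real \<Rightarrow> real ^ 'p \<Rightarrow> 'p obs" where
  "observe r y x = (r, r * y, x)"

definition train_idx :: "nat \<Rightarrow> (nat \<Rightarrow> nat set) \<Rightarrow> nat \<Rightarrow> nat set" where
  "train_idx N I k = {1..N} - I k"

definition fold_of :: "nat \<Rightarrow> (nat \<Rightarrow> nat set) \<Rightarrow> nat \<Rightarrow> nat" where
  "fold_of K I i = (THE k. k \<in> {1..K} \<and> i \<in> I k)"

text \<open>The sample of size \<open>N\<close>: \<open>Z i\<close> are i.i.d. copies of the observation \<open>Zpop\<close> from the
  population \<open>P\<close>, and \<open>I \<omega>\<close> is the random partition, with folds \<open>I \<omega> 1, \<dots>, I \<omega> K\<close>.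
  The partition and the data have different types, so their independence is expressed through
  the generated \<open>\<sigma>\<close>-algebras; it includes measurability of the partition.\<close>

locale crossfit_sample = prob_space M
  for M :: "'w measure" +
  fixes P :: "'u measure" and Zpop :: "'u \<Rightarrow> 'p::finite obs"
    and N K :: nat and Z :: "nat \<Rightarrow> 'w \<Rightarrow> 'p obs" and I :: "'w \<Rightarrow> nat \<Rightarrow> nat set"
  assumes Z_indep: "indep_vars (\<lambda>_. borel) Z {1..N}"
    and Z_copies: "i \<in> {1..N} \<Longrightarrow> distr M borel (Z i) = distr P borel Zpop"
    and folds_disjoint: "\<omega> \<in> space M \<Longrightarrow> disjoint_family_on (I \<omega>) {1..K}"
    and folds_cover: "\<omega> \<in> space M \<Longrightarrow> (\<Union>k\<in>{1..K}. I \<omega> k) = {1..N}"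
    and folds_equal_size: "\<omega> \<in> space M \<Longrightarrow> k \<in> {1..K} \<Longrightarrow> card (I \<omega> k) = N div K"
    and folds_indep_data:
      "indep_set {(\<lambda>\<omega>. restrict (I \<omega>) {1..K}) -` A \<inter> space M | A. True}
                 {(\<lambda>\<omega>. \<lambda>i\<in>{1..N}. Z i \<omega>) -` B \<inter> space M | B. B \<in> sets (Pi\<^sub>M {1..N} (\<lambda>_. borel))}"

text \<open>A learner maps a training set, given by its index set \<open>J\<close> and the observations
  \<open>D i\<close> (\<open>i \<in> J\<close>), to a function on the covariate space.\<close>

type_synonym 'p learner = "nat set \<Rightarrow> (nat \<Rightarrow> 'p obs) \<Rightarrow> real ^ 'p \<Rightarrow> real"

definition measurable_learner :: "nat \<Rightarrow> 'p::finite learner \<Rightarrow> bool" where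
  "measurable_learner N L \<longleftrightarrow> (\<forall>J\<subseteq>{1..N}.
     (\<lambda>(D, x). L J D x) \<in> borel_measurable (Pi\<^sub>M J (\<lambda>_. borel) \<Otimes>\<^sub>M borel))"

definition m_hat ::
  "'p::finite learner \<Rightarrow> nat \<Rightarrow> (nat \<Rightarrow> nat set) \<Rightarrow> (nat \<Rightarrow> 'p obs) \<Rightarrow> nat \<Rightarrow> real ^ 'p \<Rightarrow> real" where
  "m_hat L N I Z k = L (train_idx N I k) (restrict Z (train_idx N I k))"

definition pi_hat :: "nat \<Rightarrow> (nat \<Rightarrow> nat set) \<Rightarrow> (nat \<Rightarrow> real) \<Rightarrow> nat \<Rightarrow> 'x \<Rightarrow> real" where
  "pi_hat N I R k x = (\<Sum>j\<in>train_idx N I k. R j) / real (card (train_idx N I k))"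

text \<open>The estimator for given nuisance estimators: \<open>mh k\<close> and \<open>ph k\<close> are used on fold \<open>k\<close>.\<close>

definition theta_DRSS ::
  "nat \<Rightarrow> nat \<Rightarrow> (nat \<Rightarrow> nat set) \<Rightarrow> (nat \<Rightarrow> 'x \<Rightarrow> real) \<Rightarrow> (nat \<Rightarrow> 'x \<Rightarrow> real) \<Rightarrow>
   (nat \<Rightarrow> real) \<Rightarrow> (nat \<Rightarrow> real) \<Rightarrow> (nat \<Rightarrow> 'x) \<Rightarrow> real" where
  "theta_DRSS K N I mh ph R Y X =
     (1 / real N) * (\<Sum>i=1..N. let k = fold_of K I i in
        mh k (X i) + R i / ph k (X i) * (Y i - mh k (X i)))"

text \<open>The influence functions take the full \<open>(r, y, x)\<close> but depend on \<open>y\<close> only through \<open>r * y\<close>;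
  \<open>pb\<close> stands for the marginal labelling probability and \<open>\<theta>0\<close> for the target \<open>E(Y)\<close>.\<close>

definition psi_mu :: "('x \<Rightarrow> real) \<Rightarrow> real \<Rightarrow> real \<Rightarrow> real \<Rightarrow> real \<Rightarrow> 'x \<Rightarrow> real" where
  "psi_mu \<mu> pb \<theta>0 r y x = r / pb * (y - \<mu> x) + \<mu> x - \<theta>0"

definition Delta_mu ::
  "'u measure \<Rightarrow> ('u \<Rightarrow> 'x) \<Rightarrow> ('x \<Rightarrow> real) \<Rightarrow> ('x \<Rightarrow> real) \<Rightarrow> real" where
  "Delta_mu P X m \<mu> = (LINT u|P. \<mu> (X u) - m (X u))"

definition IF_pi :: "real \<Rightarrow> real \<Rightarrow> real \<Rightarrow> real" where
  "IF_pi pb \<Delta> r = (r - pb) / pb * \<Delta>"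

end

theory Submission
  imports Defs
begin

text \<open>Write \<open>p\<^sub>k\<close> for the label frequency on the training sample of fold \<open>k\<close>, \<open>b\<close> for
  \<open>pi_bar\<close>, \<open>f\<^sub>k = mh k - \<mu>\<close> and \<open>\<rho>\<^sub>k = b / p\<^sub>k - 1\<close>. The \<open>i\<close>-th summand of the remainder, \<open>i\<close> in
  fold \<open>k\<close>, is
  \<open>f\<^sub>k(X) (1 - R/b) - \<rho>\<^sub>k R f\<^sub>k(X) / b + \<rho>\<^sub>k (R (Y - \<mu>(X)) / b + \<Delta>) - \<Delta> \<rho>\<^sub>k - \<Delta> (R/b - 1)\<close>.
  Under MCAR and ignorability \<open>R\<close> is independent of \<open>(X, Y)\<close>, so given the partition and the training
  sample the first and third terms are centred and i.i.d.; their second moments are at most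
  \<open>\<parallel>f\<^sub>k\<parallel>\<^sup>2 / b\<close> and \<open>E (Y - \<mu>(X))\<^sup>2 / b\<close>, and the second has conditional absolute mean at most
  \<open>\<bar>\<rho>\<^sub>k\<bar> \<parallel>f\<^sub>k\<parallel>\<close>, while \<open>\<rho>\<^sub>k = O\<^sub>p((N b) powr (-1/2))\<close> by Chebyshev. As the folds have equal size, the
  \<open>p\<^sub>k\<close> average to the overall label frequency, so the last two terms cancel up to a multiple of
  \<open>(p\<^sub>k/b - 1)\<^sup>2\<close>.

  Since the partition takes finitely many values and is independent of the data, bounds that are
  uniform over fixed partitions carry over to the random one.\<close>

subsection \<open>Sums over independent coordinates\<close>

text \<open>The delicate term is \<rho>_k R (Y - \<mu>(X)) / b. If \<mu> is wrong, the factor after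
  \<rho>_k has mean -\<Delta>, which need not vanish, so the average over the sample is of order (N
  b) powr (-1/2), the very order at which errors must be negligible. Recentring by \<Delta> splits
  off -\<Delta> \<rho>_k. The linear part of this is \<Delta> times the relative error of the
  training label frequency; its average over the folds is the average of \<open>IF_pi\<close>, and
  this is where that correction comes from.

  Two obstacles shape the rest. The error f_k is small only in probability and may fail to be square
  integrable, so conditional moments exist only for some training samples; the bounds therefore
  read: outside an event of probability at most 1/H, if the fit is good, then the sum is small. And
  p_k may be close to 0, so b / p_k is handled pointwise, where p_k / b - 1 is at most 1/2 in
  absolute value. Conditioning on the training sample is carried out by Tonelli's theorem on a
  product measure.\<close>

lemma nn_integral_PiM_sum_square:
  fixes f :: "'a \<Rightarrow> real"
  assumes "prob_space Q" "finite F"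
    and f: "integrable Q f" and f2: "integrable Q (\<lambda>z. (f z)\<^sup>2)" and mean: "(LINT z|Q. f z) = 0"
  shows "(\<integral>\<^sup>+e. ennreal ((\<Sum>i\<in>F. f (e i))\<^sup>2) \<partial>Pi\<^sub>M F (\<lambda>_. Q))
    = ennreal (real (card F) * (LINT z|Q. (f z)\<^sup>2))"
  using \<open>finite F\<close>
proof (induction F)
  case empty
  show ?case by simp
next
  case (insert j F)
  interpret Q: prob_space Q by fact
  interpret product_prob_space "\<lambda>_. Q" F ..
  interpret PF: prob_space "Pi\<^sub>M F (\<lambda>_. Q)" by (rule prob_space_PiM) (rule assms(1))
  have [measurable]: "f \<in> borel_measurable Q" using f by auto
  let ?v = "LINT z|Q. (f z)\<^sup>2"
  have v: "0 \<le> ?v" by simp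
  \<comment> \<open>Integrating out the new coordinate kills the cross term
    \<open>2 * f y * s\<close>, because \<open>f\<close> is centred.\<close>
  have inner: "(\<integral>\<^sup>+y. ennreal ((f y + s)\<^sup>2) \<partial>Q) = ennreal ?v + ennreal (s\<^sup>2)" for s
  proof -
    have "(\<integral>\<^sup>+y. ennreal ((f y + s)\<^sup>2) \<partial>Q) = ennreal (LINT y|Q. (f y + s)\<^sup>2)"
    proof (rule nn_integral_eq_integral)
      show "integrable Q (\<lambda>y. (f y + s)\<^sup>2)" using f f2 by (simp add: power2_sum)
    qed simp
    also have "(LINT y|Q. (f y + s)\<^sup>2) = ?v + s\<^sup>2"
      using f f2 mean by (simp add: power2_sum Q.prob_space)
    finally show ?thesis using v by simp
  qed
  have "(\<integral>\<^sup>+e. ennreal ((\<Sum>i\<in>insert j F. f (e i))\<^sup>2) \<partial>Pi\<^sub>M (insert j F) (\<lambda>_. Q))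
      = (\<integral>\<^sup>+x. (\<integral>\<^sup>+y. ennreal ((\<Sum>i\<in>insert j F. f ((x(j := y)) i))\<^sup>2) \<partial>Q) \<partial>Pi\<^sub>M F (\<lambda>_. Q))"
    using insert.hyps by (intro product_nn_integral_insert) auto
  also have "\<dots> = (\<integral>\<^sup>+x. ennreal ?v + ennreal ((\<Sum>i\<in>F. f (x i))\<^sup>2) \<partial>Pi\<^sub>M F (\<lambda>_. Q))"
  proof (intro nn_integral_cong)
    fix x
    have "(\<Sum>i\<in>insert j F. f ((x(j := y)) i)) = f y + (\<Sum>i\<in>F. f (x i))" for y
      using insert.hyps by (auto intro!: sum.cong)
    then show "(\<integral>\<^sup>+y. ennreal ((\<Sum>i\<in>insert j F. f ((x(j := y)) i))\<^sup>2) \<partial>Q)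
        = ennreal ?v + ennreal ((\<Sum>i\<in>F. f (x i))\<^sup>2)"
      using inner by simp
  qed
  also have "\<dots> = ennreal ?v + ennreal (real (card F) * ?v)"
    by (subst nn_integral_add) (auto simp: insert.IH prob_space.emeasure_space_1[OF prob_space_PiM[OF assms(1)], of F])
  also have "\<dots> = ennreal (real (card (insert j F)) * ?v)"
    using insert.hyps v by (simp add: ennreal_plus[symmetric] algebra_simps del: ennreal_plus)
  finally show ?case .
qed

lemma nn_integral_PiM_sum:
  fixes g :: "'a \<Rightarrow> ennreal"
  assumes "prob_space Q" and [measurable]: "g \<in> borel_measurable Q"
  shows "(\<integral>\<^sup>+e. (\<Sum>i\<in>F. g (e i)) \<partial>Pi\<^sub>M F (\<lambda>_. Q)) = of_nat (card F) * (\<integral>\<^sup>+z. g z \<partial>Q)"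
proof -
  have "(\<integral>\<^sup>+e. g (e i) \<partial>Pi\<^sub>M F (\<lambda>_. Q)) = (\<integral>\<^sup>+z. g z \<partial>Q)" if "i \<in> F" for i
  proof -
    have "(\<integral>\<^sup>+z. g z \<partial>Q) = (\<integral>\<^sup>+z. g z \<partial>distr (Pi\<^sub>M F (\<lambda>_. Q)) Q (\<lambda>e. e i))"
      using assms that by (subst distr_PiM_component) auto
    also have "\<dots> = (\<integral>\<^sup>+e. g (e i) \<partial>Pi\<^sub>M F (\<lambda>_. Q))"
      using that by (subst nn_integral_distr) auto
    finally show ?thesis by simp
  qed
  then show ?thesis
    by (subst nn_integral_sum) auto
qed

lemma nn_integral_PiM_split_le:
  assumes "prob_space Q" "J \<inter> F = {}" "finite J" "finite F"
    and h[measurable]: "h \<in> borel_measurable (Pi\<^sub>M J (\<lambda>_. Q) \<Otimes>\<^sub>M Pi\<^sub>M F (\<lambda>_. Q))"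
    and le: "\<And>d. d \<in> space (Pi\<^sub>M J (\<lambda>_. Q)) \<Longrightarrow> (\<integral>\<^sup>+e. h (d, e) \<partial>Pi\<^sub>M F (\<lambda>_. Q)) \<le> c"
  shows "(\<integral>\<^sup>+D. h (restrict D J, restrict D F) \<partial>Pi\<^sub>M (J \<union> F) (\<lambda>_. Q)) \<le> c"
proof -
  interpret Q: prob_space Q by fact
  interpret J: product_prob_space "\<lambda>_. Q" J ..
  have [measurable]: "(\<lambda>D. restrict D J) \<in> measurable (Pi\<^sub>M (J \<union> F) (\<lambda>_. Q)) (Pi\<^sub>M J (\<lambda>_. Q))"
    "(\<lambda>D. restrict D F) \<in> measurable (Pi\<^sub>M (J \<union> F) (\<lambda>_. Q)) (Pi\<^sub>M F (\<lambda>_. Q))"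
    by (auto intro!: measurable_restrict_subset)
  have "(\<integral>\<^sup>+D. h (restrict D J, restrict D F) \<partial>Pi\<^sub>M (J \<union> F) (\<lambda>_. Q))
      = (\<integral>\<^sup>+d. (\<integral>\<^sup>+e. h (restrict (merge J F (d, e)) J, restrict (merge J F (d, e)) F)
          \<partial>Pi\<^sub>M F (\<lambda>_. Q)) \<partial>Pi\<^sub>M J (\<lambda>_. Q))"
    using assms by (intro J.product_nn_integral_fold) auto
  also have "\<dots> = (\<integral>\<^sup>+d. (\<integral>\<^sup>+e. h (d, e) \<partial>Pi\<^sub>M F (\<lambda>_. Q)) \<partial>Pi\<^sub>M J (\<lambda>_. Q))"
    using assms(2) by (intro nn_integral_cong) (auto simp: space_PiM PiE_def extensional_restrict)
  also have "\<dots> \<le> (\<integral>\<^sup>+d. c \<partial>Pi\<^sub>M J (\<lambda>_. Q))"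
    by (intro nn_integral_mono le)
  finally show ?thesis
    using prob_space.emeasure_space_1[OF prob_space_PiM[OF assms(1)], of J] by simp
qed

subsection \<open>Randomness of the partition\<close>

text \<open>The values are extensional functions on \<open>{1..K}\<close>. The raw map
  \<open>I \<omega>\<close> is unconstrained outside \<open>{1..K}\<close>, so only its restriction
  is sure to range over a finite set.\<close>

definition equal_folds :: "nat \<Rightarrow> nat \<Rightarrow> (nat \<Rightarrow> nat set) set" where
  "equal_folds N K = {\<kappa> \<in> {1..K} \<rightarrow>\<^sub>E Pow {1..N}. disjoint_family_on \<kappa> {1..K} \<and>
     (\<Union>k\<in>{1..K}. \<kappa> k) = {1..N} \<and> (\<forall>k\<in>{1..K}. card (\<kappa> k) = N div K)}"

lemma finite_equal_folds: "finite (equal_folds N K)"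
  unfolding equal_folds_def by (rule finite_subset[of _ "{1..K} \<rightarrow>\<^sub>E Pow {1..N}"]) (auto intro: finite_PiE)

context crossfit_sample
begin

definition folds :: "'w \<Rightarrow> nat \<Rightarrow> nat set" where
  "folds \<omega> = restrict (I \<omega>) {1..K}"

definition data :: "'w \<Rightarrow> nat \<Rightarrow> real \<times> real \<times> (real ^ 'p)" where
  "data \<omega> = (\<lambda>i\<in>{1..N}. Z i \<omega>)"

abbreviation "obs_law \<equiv> distr P borel Zpop"

lemma Z_measurable: "i \<in> {1..N} \<Longrightarrow> Z i \<in> borel_measurable M"
  using Z_indep by (auto simp: indep_vars_def)

lemma prob_space_obs_law: assumes "N > 0" shows "prob_space obs_law"
  using Z_copies[of 1] Z_measurable[of 1] assms by (metis prob_space_distr atLeastAtMost_iff le_refl less_eq_Suc_le One_nat_def)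

lemma folds_in: "\<omega> \<in> space M \<Longrightarrow> folds \<omega> \<in> equal_folds N K"
  using folds_cover[of \<omega>] folds_disjoint[of \<omega>] folds_equal_size[of \<omega>]
  by (auto simp: equal_folds_def folds_def disjoint_family_on_def)

lemma data_measurable [measurable]: "data \<in> measurable M (Pi\<^sub>M {1..N} (\<lambda>_. borel))"
  unfolding data_def using Z_measurable by (intro measurable_restrict) auto

lemma data_law: assumes "N > 0"
  shows "distr M (Pi\<^sub>M {1..N} (\<lambda>_. borel)) data = Pi\<^sub>M {1..N} (\<lambda>_. obs_law)"
proof -
  have "distr M (Pi\<^sub>M {1..N} (\<lambda>_. borel)) data = Pi\<^sub>M {1..N} (\<lambda>i. distr M borel (Z i))"
    using indep_vars_iff_distr_eq_PiM'[of "{1..N}" Z "\<lambda>_. borel"] Z_indep Z_measurable assms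
    unfolding data_def by simp
  also have "\<dots> = Pi\<^sub>M {1..N} (\<lambda>_. obs_law)"
    by (intro PiM_cong) (auto simp: Z_copies)
  finally show ?thesis .
qed

lemma folds_event: "{\<omega> \<in> space M. folds \<omega> = \<kappa>} \<in> events"
proof -
  have "(\<lambda>\<omega>. restrict (I \<omega>) {1..K}) -` {\<kappa>} \<inter> space M \<in> events"
    using indep_setD_ev1[OF folds_indep_data] by blast
  also have "(\<lambda>\<omega>. restrict (I \<omega>) {1..K}) -` {\<kappa>} \<inter> space M = {\<omega> \<in> space M. folds \<omega> = \<kappa>}"
    by (auto simp: folds_def)
  finally show ?thesis .
qed

lemma folds_measurable: "folds \<in> measurable M (count_space (equal_folds N K))"
  using folds_in folds_event finite_equal_folds
  by (subst measurable_count_space_eq2) (auto simp: vimage_def Int_def conj_commute)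

lemma measurable_folds_data:
  assumes "\<And>\<kappa>. \<kappa> \<in> equal_folds N K \<Longrightarrow> G \<kappa> \<in> measurable (Pi\<^sub>M {1..N} (\<lambda>_. borel)) L"
  shows "(\<lambda>\<omega>. G (folds \<omega>) (data \<omega>)) \<in> measurable M L"
  by (rule measurable_compose_countable'[where I = "equal_folds N K" and f = "\<lambda>\<kappa> \<omega>. G \<kappa> (data \<omega>)", OF _ folds_measurable])
     (use assms in \<open>auto intro: countable_finite finite_equal_folds measurable_compose[OF data_measurable]\<close>)

text \<open>Total probability over the values of \<open>folds\<close>: on
  \<open>folds \<omega> = \<kappa>\<close> the event reads
  \<open>data \<omega> \<in> A \<kappa>\<close>, and independence factors its probability, leaving a
  convex combination of numbers at most \<open>c\<close>.\<close>

lemma prob_folds_data_le: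
  assumes "N > 0"
    and A: "\<And>\<kappa>. \<kappa> \<in> equal_folds N K \<Longrightarrow> A \<kappa> \<in> sets (Pi\<^sub>M {1..N} (\<lambda>_. borel))"
    and le: "\<And>\<kappa>. \<kappa> \<in> equal_folds N K \<Longrightarrow> measure (Pi\<^sub>M {1..N} (\<lambda>_. obs_law)) (A \<kappa>) \<le> c"
  shows "prob {\<omega> \<in> space M. data \<omega> \<in> A (folds \<omega>)} \<le> c"
proof -
  let ?E = "\<lambda>\<kappa>. {\<omega> \<in> space M. folds \<omega> = \<kappa>}" and ?D = "\<lambda>\<kappa>. {\<omega> \<in> space M. data \<omega> \<in> A \<kappa>}"
  have D: "?D \<kappa> \<in> events" if "\<kappa> \<in> equal_folds N K" for \<kappa>
    using A[OF that] by measurable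
  have prod: "prob (?E \<kappa> \<inter> ?D \<kappa>) = prob (?E \<kappa>) * prob (?D \<kappa>)" if "\<kappa> \<in> equal_folds N K" for \<kappa>
  proof (rule indep_setD[OF folds_indep_data])
    show "?E \<kappa> \<in> {(\<lambda>\<omega>. restrict (I \<omega>) {1..K}) -` A \<inter> space M |A. True}"
      by (intro CollectI exI[of _ "{\<kappa>}"]) (auto simp: folds_def)
    show "?D \<kappa> \<in> {(\<lambda>\<omega>. \<lambda>i\<in>{1..N}. Z i \<omega>) -` B \<inter> space M | B. B \<in> sets (Pi\<^sub>M {1..N} (\<lambda>_. borel))}"
      using A[OF that] by (intro CollectI exI[of _ "A \<kappa>"]) (auto simp: data_def)
  qed
  have law: "prob (?D \<kappa>) \<le> c" if "\<kappa> \<in> equal_folds N K" for \<kappa>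
  proof -
    have "prob (?D \<kappa>) = measure (distr M (Pi\<^sub>M {1..N} (\<lambda>_. borel)) data) (A \<kappa>)"
      using A[OF that] by (subst measure_distr[OF data_measurable]) (auto intro: arg_cong[where f = prob])
    then show ?thesis using le[OF that] data_law[OF assms(1)] by simp
  qed
  have "{\<omega> \<in> space M. data \<omega> \<in> A (folds \<omega>)} = (\<Union>\<kappa>\<in>equal_folds N K. ?E \<kappa> \<inter> ?D \<kappa>)"
    using folds_in by auto
  also have "prob \<dots> = (\<Sum>\<kappa>\<in>equal_folds N K. prob (?E \<kappa> \<inter> ?D \<kappa>))"
    using D folds_event finite_equal_folds
    by (intro finite_measure_finite_Union) (auto simp: disjoint_family_on_def)
  also have "\<dots> \<le> (\<Sum>\<kappa>\<in>equal_folds N K. prob (?E \<kappa>) * c)"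
    using prod law by (intro sum_mono) (auto intro: mult_left_mono)
  also have "\<dots> = (\<Sum>\<kappa>\<in>equal_folds N K. prob (?E \<kappa>)) * c"
    by (simp add: sum_distrib_right)
  also have "(\<Sum>\<kappa>\<in>equal_folds N K. prob (?E \<kappa>)) = prob (\<Union>\<kappa>\<in>equal_folds N K. ?E \<kappa>)"
    using folds_event finite_equal_folds
    by (intro finite_measure_finite_Union[symmetric]) (auto simp: disjoint_family_on_def)
  also have "(\<Union>\<kappa>\<in>equal_folds N K. ?E \<kappa>) = space M"
    using folds_in by auto
  finally show ?thesis by (simp add: prob_space)
qed

text \<open>Markov's inequality for each fixed partition. Since \<open>h\<close> is extended-valued,
  the bound on its integral doubles as the integrability statement.\<close>

lemma prob_folds_data_Markov:
  fixes h :: "(nat \<Rightarrow> nat set) \<Rightarrow> (nat \<Rightarrow> real \<times> real \<times> (real ^ 'p)) \<Rightarrow> ennreal"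
  assumes "N > 0" "0 < t" "0 \<le> c"
    and h: "\<And>\<kappa>. \<kappa> \<in> equal_folds N K \<Longrightarrow> h \<kappa> \<in> borel_measurable (Pi\<^sub>M {1..N} (\<lambda>_. borel))"
    and le: "\<And>\<kappa>. \<kappa> \<in> equal_folds N K \<Longrightarrow>
      (\<integral>\<^sup>+D. h \<kappa> D \<partial>Pi\<^sub>M {1..N} (\<lambda>_. obs_law)) \<le> ennreal c"
  shows "prob {\<omega> \<in> space M. h (folds \<omega>) (data \<omega>) > ennreal t} \<le> c / t"
proof -
  interpret Q: prob_space obs_law by (rule prob_space_obs_law) fact
  interpret PN: prob_space "Pi\<^sub>M {1..N} (\<lambda>_. obs_law)"
    by (rule prob_space_PiM) (rule prob_space_obs_law[OF assms(1)])
  have sp: "space (Pi\<^sub>M {1..N} (\<lambda>_. obs_law)) = space (Pi\<^sub>M {1..N} (\<lambda>_. borel))"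
    by (simp add: space_PiM)
  have st: "sets (Pi\<^sub>M {1..N} (\<lambda>_. obs_law)) = sets (Pi\<^sub>M {1..N} (\<lambda>_. borel))"
    by (intro sets_PiM_cong) auto
  let ?A = "\<lambda>\<kappa>. {D \<in> space (Pi\<^sub>M {1..N} (\<lambda>_. borel)). h \<kappa> D > ennreal t}"
  have "prob {\<omega> \<in> space M. data \<omega> \<in> ?A (folds \<omega>)} \<le> c / t"
  proof (rule prob_folds_data_le)
    fix \<kappa> assume k: "\<kappa> \<in> equal_folds N K"
    note [measurable] = h[OF k]
    show A: "?A \<kappa> \<in> sets (Pi\<^sub>M {1..N} (\<lambda>_. borel))"
      by measurable
    have hm: "h \<kappa> \<in> borel_measurable (Pi\<^sub>M {1..N} (\<lambda>_. obs_law))"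
      using h[OF k] by (simp cong: measurable_cong_sets[OF st])
    have "emeasure (Pi\<^sub>M {1..N} (\<lambda>_. obs_law)) (?A \<kappa>)
      \<le> emeasure (Pi\<^sub>M {1..N} (\<lambda>_. obs_law)) {D \<in> space (Pi\<^sub>M {1..N} (\<lambda>_. obs_law)). 1 \<le> ennreal (1 / t) * h \<kappa> D}"
    proof (intro emeasure_mono)
      show "?A \<kappa> \<subseteq> {D \<in> space (Pi\<^sub>M {1..N} (\<lambda>_. obs_law)). 1 \<le> ennreal (1 / t) * h \<kappa> D}"
      proof safe
        fix D assume "h \<kappa> D > ennreal t" "D \<in> space (Pi\<^sub>M {1..N} (\<lambda>_. borel))"
        then show "D \<in> space (Pi\<^sub>M {1..N} (\<lambda>_. obs_law))" using sp by simp
        have "1 = ennreal (1 / t) * ennreal t"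
          using assms by (simp add: ennreal_mult[symmetric] del: ennreal_1 flip: ennreal_1)
        also have "\<dots> \<le> ennreal (1 / t) * h \<kappa> D"
          using \<open>h \<kappa> D > ennreal t\<close> by (intro mult_left_mono) auto
        finally show "1 \<le> ennreal (1 / t) * h \<kappa> D" .
      qed
    qed (use hm in measurable)
    also have "\<dots> \<le> ennreal (1 / t) * (\<integral>\<^sup>+D. h \<kappa> D * indicator (space (Pi\<^sub>M {1..N} (\<lambda>_. obs_law))) D \<partial>Pi\<^sub>M {1..N} (\<lambda>_. obs_law))"
      using hm by (intro nn_integral_Markov_inequality) auto
    also have "\<dots> = ennreal (1 / t) * (\<integral>\<^sup>+D. h \<kappa> D \<partial>Pi\<^sub>M {1..N} (\<lambda>_. obs_law))"
      by (intro arg_cong2[where f = "(*)"] nn_integral_cong) auto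
    also have "\<dots> \<le> ennreal (1 / t) * ennreal c"
      by (intro mult_left_mono le k) auto
    also have "\<dots> = ennreal (c / t)"
      using assms by (simp add: ennreal_mult[symmetric])
    finally show "measure (Pi\<^sub>M {1..N} (\<lambda>_. obs_law)) (?A \<kappa>) \<le> c / t"
      using assms(2,3) unfolding PN.emeasure_eq_measure by (subst (asm) ennreal_le_iff) auto
  qed fact
  also have "{\<omega> \<in> space M. data \<omega> \<in> ?A (folds \<omega>)} = {\<omega> \<in> space M. h (folds \<omega>) (data \<omega>) > ennreal t}"
    using measurable_space[OF data_measurable] by auto
  finally show ?thesis .
qed

end

subsection \<open>Independence of labels and outcomes\<close>

lemma (in prob_space) vimage_subalgebra:
  assumes "X \<in> borel_measurable M"
  shows "finite_measure_subalgebra M (vimage_algebra (space M) X borel)"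
proof
  show "subalgebra M (vimage_algebra (space M) X borel)"
    unfolding subalgebra_def using assms by (auto simp: sets_vimage_algebra2 measurable_sets)
qed

context missing_data_population
begin

lemmas [measurable] = R_measurable Y_measurable X_measurable

lemma R_eq_indicator: "u \<in> space P \<Longrightarrow> R N u = indicator {1} (R N u)"
  using R_binary[of u N] by auto

lemma R_nonneg: "u \<in> space P \<Longrightarrow> 0 \<le> R N u" and R_le_1: "u \<in> space P \<Longrightarrow> R N u \<le> 1"
  and R_square: "u \<in> space P \<Longrightarrow> (R N u)\<^sup>2 = R N u"
  using R_binary[of u N] by auto

text \<open>The indicator of \<open>B\<close> at \<open>X\<close> is measurable for the
  \<sigma>-algebra of \<open>X\<close>, so it passes through the conditional expectation;
  ignorability then factors what is left, and MCAR turns the factor of the label into the constant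
  \<open>b\<close>.\<close>

lemma mcar_rectangle:
  assumes mcar: "AE u in P. cond_E P X (\<lambda>u. indicator {1} (R N u)) u = b"
    and [measurable]: "A \<in> sets borel" "B \<in> sets borel"
  shows "(LINT u|P. R N u * (indicator A (Y u) * indicator B (X u)))
    = b * (LINT u|P. indicator A (Y u) * indicator B (X u))"
proof -
  let ?F = "vimage_algebra (space P) X borel"
  interpret F: finite_measure_subalgebra P ?F
    by (rule vimage_subalgebra) measurable
  let ?S = "\<lambda>u. indicator {1} (R N u) :: real" and ?A = "\<lambda>u. indicator A (Y u) :: real"
    and ?B = "\<lambda>u. indicator B (X u) :: real"
  have "X \<in> measurable ?F borel"
    by (rule measurable_vimage_algebra1) simp
  then have BF [measurable]: "?B \<in> borel_measurable ?F"
    by measurable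
  have bounded: "integrable P f" if "f \<in> borel_measurable P" "\<And>u. norm (f u) \<le> 1" for f :: "'u \<Rightarrow> real"
    using that by (intro integrable_const_bound[where B = 1]) auto
  have iSA: "integrable P (\<lambda>u. ?B u * (?S u * ?A u))" "integrable P (\<lambda>u. ?B u * ?A u)"
    by (auto intro!: bounded simp: indicator_def)
  have "(LINT u|P. R N u * (?A u * ?B u)) = (LINT u|P. ?B u * (?S u * ?A u))"
    by (intro Bochner_Integration.integral_cong refl) (simp add: R_eq_indicator[symmetric])
  also have "\<dots> = (LINT u|P. ?B u * cond_E P X (\<lambda>u. ?S u * ?A u) u)"
    unfolding cond_E_def using iSA(1) by (intro F.real_cond_exp_intg(2)[symmetric]) auto
  also have "\<dots> = (LINT u|P. b * (?B u * cond_E P X ?A u))"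
  proof (rule integral_cong_AE)
    have "{1} \<in> sets (borel :: real measure)" by simp
    then have "AE u in P. cond_E P X (\<lambda>u. ?S u * ?A u) u = cond_E P X ?S u * cond_E P X ?A u"
      using ignorability[of N] assms(2) unfolding cond_indep_def by blast
    with mcar show "AE u in P. ?B u * cond_E P X (\<lambda>u. ?S u * ?A u) u = b * (?B u * cond_E P X ?A u)"
      by eventually_elim simp
  qed (auto simp: cond_E_def)
  also have "\<dots> = b * (LINT u|P. ?B u * ?A u)"
    unfolding cond_E_def using iSA(2) by (simp add: F.real_cond_exp_intg(2))
  finally show ?thesis by (simp add: mult.commute)
qed

text \<open>Under MCAR, ignorability amounts to independence of \<open>R\<close> and \<open>(Y, X)\<close>.\<close>

lemma mcar_distr:
  assumes mcar: "AE u in P. cond_E P X (\<lambda>u. indicator {1} (R N u)) u = b" and "0 \<le> b"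
  shows "distr (density P (\<lambda>u. ennreal (R N u))) borel (\<lambda>u. (Y u, X u))
    = distr (density P (\<lambda>u. ennreal b)) borel (\<lambda>u. (Y u, X u))"
proof (rule measure_eqI_generator_eq)
  let ?E = "{A \<times> B | A B. A \<in> sets (borel :: real measure) \<and> B \<in> sets (borel :: (real ^ 'p) measure)}"
  show "Int_stable ?E"
    by (rule Int_stable_pair_measure_generator)
  have sets: "sets (borel :: (real \<times> (real ^ 'p)) measure) = sigma_sets UNIV ?E"
    unfolding borel_prod[symmetric] sets_pair_measure by simp
  show "sets (distr (density P (\<lambda>u. ennreal (R N u))) borel (\<lambda>u. (Y u, X u))) = sigma_sets UNIV ?E"
    "sets (distr (density P (\<lambda>u. ennreal b)) borel (\<lambda>u. (Y u, X u))) = sigma_sets UNIV ?E"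
    by (simp_all add: sets)
  have sub: "?E \<subseteq> sets (borel :: (real \<times> (real ^ 'p)) measure)"
    unfolding sets by auto
  \<comment> \<open>A general bounded weight \<open>g\<close> serves both measures to be compared:
    \<open>g = R N\<close> on the left and the constant \<open>b\<close> on the right. The case of
    the whole space also yields the finiteness required by the uniqueness theorem.\<close>
  have mean: "emeasure (distr (density P (\<lambda>u. ennreal (g u))) borel (\<lambda>u. (Y u, X u))) (A \<times> B)
      = ennreal (LINT u|P. g u * (indicator A (Y u) * indicator B (X u)))"
    if [measurable]: "A \<in> sets borel" "B \<in> sets borel" "g \<in> borel_measurable P"
      and g: "\<And>u. u \<in> space P \<Longrightarrow> 0 \<le> g u \<and> g u \<le> c"
    for A and B :: "(real ^ 'p) set" and g and c :: real
  proof -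
    have [measurable]: "A \<times> B \<in> sets (borel :: (real \<times> (real ^ 'p)) measure)"
      using sub that(1,2) by blast
    have "emeasure (distr (density P (\<lambda>u. ennreal (g u))) borel (\<lambda>u. (Y u, X u))) (A \<times> B)
        = (\<integral>\<^sup>+u. ennreal (g u * (indicator A (Y u) * indicator B (X u))) \<partial>P)"
      by (subst emeasure_distr, measurable, subst emeasure_density)
         (auto intro!: nn_integral_cong simp: indicator_def g split: if_splits)
    also have "\<dots> = ennreal (LINT u|P. g u * (indicator A (Y u) * indicator B (X u)))"
    proof (rule nn_integral_eq_integral)
      have "norm (g u * (indicator A (Y u) * indicator B (X u))) \<le> c" if "u \<in> space P" for u
        using g[OF that] by (auto simp: indicator_def)
      then show "integrable P (\<lambda>u. g u * (indicator A (Y u) * indicator B (X u)))"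
        by (intro integrable_const_bound[where B = c] AE_I2) auto
    qed (use g in auto)
    finally show ?thesis .
  qed
  show "emeasure (distr (density P (\<lambda>u. ennreal (R N u))) borel (\<lambda>u. (Y u, X u))) D
      = emeasure (distr (density P (\<lambda>u. ennreal b)) borel (\<lambda>u. (Y u, X u))) D" if "D \<in> ?E" for D
  proof -
    from that obtain A B where D: "D = A \<times> B" and [measurable]: "A \<in> sets borel" "B \<in> sets borel"
      by auto
    have "emeasure (distr (density P (\<lambda>u. ennreal (R N u))) borel (\<lambda>u. (Y u, X u))) (A \<times> B)
        = ennreal (LINT u|P. R N u * (indicator A (Y u) * indicator B (X u)))"
      using R_nonneg R_le_1 by (intro mean[of A B "R N" 1]) auto
    also have "\<dots> = ennreal (LINT u|P. b * (indicator A (Y u) * indicator B (X u)))"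
      by (simp add: mcar_rectangle[OF mcar])
    also have "\<dots> = emeasure (distr (density P (\<lambda>u. ennreal b)) borel (\<lambda>u. (Y u, X u))) (A \<times> B)"
      using \<open>0 \<le> b\<close> by (intro mean[of A B "\<lambda>_. b" b, symmetric]) auto
    finally show ?thesis unfolding D .
  qed
  show "range (\<lambda>_. UNIV \<times> UNIV) \<subseteq> ?E"
    by (rule image_subsetI, rule CollectI, rule exI[of _ UNIV], rule exI[of _ UNIV]) auto
  show "emeasure (distr (density P (\<lambda>u. ennreal (R N u))) borel (\<lambda>u. (Y u, X u))) (UNIV \<times> UNIV) \<noteq> \<infinity>" for i :: nat
    using R_nonneg R_le_1 by (subst mean[of UNIV UNIV "R N" 1]) auto
qed auto

lemma mcar_nn_integral:
  assumes mcar: "AE u in P. cond_E P X (\<lambda>u. indicator {1} (R N u)) u = b" and "0 \<le> b"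
    and [measurable]: "h \<in> borel_measurable borel"
  shows "(\<integral>\<^sup>+u. ennreal (R N u) * h (Y u, X u) \<partial>P) = ennreal b * (\<integral>\<^sup>+u. h (Y u, X u) \<partial>P)"
proof -
  have "(\<integral>\<^sup>+u. ennreal (R N u) * h (Y u, X u) \<partial>P)
      = (\<integral>\<^sup>+z. h z \<partial>distr (density P (\<lambda>u. ennreal (R N u))) borel (\<lambda>u. (Y u, X u)))"
    by (simp add: nn_integral_distr nn_integral_density)
  also have "\<dots> = (\<integral>\<^sup>+u. ennreal b * h (Y u, X u) \<partial>P)"
    unfolding mcar_distr[OF assms(1,2)] by (simp add: nn_integral_distr nn_integral_density)
  also have "\<dots> = ennreal b * (\<integral>\<^sup>+u. h (Y u, X u) \<partial>P)"
    by (simp add: nn_integral_cmult)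
  finally show ?thesis .
qed

lemma mcar_integral:
  fixes h :: "real \<times> (real ^ 'p) \<Rightarrow> real"
  assumes mcar: "AE u in P. cond_E P X (\<lambda>u. indicator {1} (R N u)) u = b" and "0 \<le> b"
    and [measurable]: "h \<in> borel_measurable borel" and int: "integrable P (\<lambda>u. h (Y u, X u))"
  shows "integrable P (\<lambda>u. R N u * h (Y u, X u))"
    and "(LINT u|P. R N u * h (Y u, X u)) = b * (LINT u|P. h (Y u, X u))"
proof -
  show "integrable P (\<lambda>u. R N u * h (Y u, X u))"
    using R_nonneg R_le_1
    by (intro Bochner_Integration.integrable_bound[OF int]) (auto simp: abs_mult intro!: mult_left_le_one_le)
  have "(LINT u|P. R N u * h (Y u, X u))
      = (LINT z|distr (density P (\<lambda>u. ennreal (R N u))) borel (\<lambda>u. (Y u, X u)). h z)"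
    using R_nonneg by (simp add: integral_distr integral_density AE_I2)
  also have "\<dots> = (LINT u|P. b * h (Y u, X u))"
    unfolding mcar_distr[OF assms(1,2)] using \<open>0 \<le> b\<close> by (simp add: integral_distr integral_density)
  finally show "(LINT u|P. R N u * h (Y u, X u)) = b * (LINT u|P. h (Y u, X u))"
    by simp
qed

lemma observe_measurable: "(\<lambda>u. observe (R N u) (Y u) (X u)) \<in> borel_measurable P"
  unfolding observe_def by measurable

end

subsection \<open>Conditional moments given the training sample\<close>

definition label :: "real \<times> real \<times> 'x \<Rightarrow> real" where "label z = fst z"
text \<open>This coordinate holds \<open>R * Y\<close>; where the label is 0 the outcome itself
  cannot be recovered from it.\<close>

definition labelled_outcome :: "real \<times> real \<times> 'x \<Rightarrow> real" where "labelled_outcome z = fst (snd z)"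
definition covariate :: "real \<times> real \<times> 'x \<Rightarrow> 'x" where "covariate z = snd (snd z)"

lemma observe_simps [simp]:
  "label (observe r y x) = r" "labelled_outcome (observe r y x) = r * y" "covariate (observe r y x) = x"
  by (simp_all add: observe_def label_def labelled_outcome_def covariate_def)

lemma obs_measurable [measurable]:
  "label \<in> borel_measurable (borel :: (real \<times> real \<times> (real ^ 'p)) measure)"
  "labelled_outcome \<in> borel_measurable (borel :: (real \<times> real \<times> (real ^ 'p)) measure)"
  "covariate \<in> borel_measurable (borel :: (real \<times> real \<times> (real ^ 'p)) measure)"
  unfolding label_def labelled_outcome_def covariate_def
  by (auto intro!: borel_measurable_continuous_onI continuous_intros)

text \<open>Given \<open>d\<close>, the summands are i.i.d. and centred, so their variances add. The
  set \<open>G\<close> collects the training data for which the moments exist and are small; its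
  indicator makes the integrand vanish elsewhere.\<close>

lemma nn_integral_PiM_centered_sum_le:
  fixes \<phi> :: "('i \<Rightarrow> 'a) \<Rightarrow> 'a \<Rightarrow> real"
  assumes Q: "prob_space Q" and JF: "J \<inter> F = {}" "finite J" "finite F"
    and [measurable]: "G \<in> sets (Pi\<^sub>M J (\<lambda>_. Q))"
      "(\<lambda>(d, z). \<phi> d z) \<in> borel_measurable (Pi\<^sub>M J (\<lambda>_. Q) \<Otimes>\<^sub>M Q)"
    and int: "\<And>d. d \<in> G \<Longrightarrow> integrable Q (\<phi> d)" "\<And>d. d \<in> G \<Longrightarrow> integrable Q (\<lambda>z. (\<phi> d z)\<^sup>2)"
    and mean: "\<And>d. d \<in> G \<Longrightarrow> (LINT z|Q. \<phi> d z) = 0"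
    and var: "\<And>d. d \<in> G \<Longrightarrow> (LINT z|Q. (\<phi> d z)\<^sup>2) \<le> v"
  shows "(\<integral>\<^sup>+D. indicator G (restrict D J) * ennreal ((\<Sum>i\<in>F. \<phi> (restrict D J) (D i))\<^sup>2)
    \<partial>Pi\<^sub>M (J \<union> F) (\<lambda>_. Q)) \<le> ennreal (real (card F) * v)"
proof -
  define h where "h = (\<lambda>(d, e). indicator G d * ennreal ((\<Sum>i\<in>F. \<phi> d (e i))\<^sup>2))"
  have [measurable]: "(\<lambda>p. \<phi> (fst p) (snd p i)) \<in> borel_measurable (Pi\<^sub>M J (\<lambda>_. Q) \<Otimes>\<^sub>M Pi\<^sub>M F (\<lambda>_. Q))"
    if "i \<in> F" for i
  proof -
    have "(\<lambda>p. (fst p, snd p i)) \<in> Pi\<^sub>M J (\<lambda>_. Q) \<Otimes>\<^sub>M Pi\<^sub>M F (\<lambda>_. Q) \<rightarrow>\<^sub>M Pi\<^sub>M J (\<lambda>_. Q) \<Otimes>\<^sub>M Q"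
      using that by measurable
    from measurable_compose[OF this assms(6)] show ?thesis by simp
  qed
  have "(\<integral>\<^sup>+D. h (restrict D J, restrict D F) \<partial>Pi\<^sub>M (J \<union> F) (\<lambda>_. Q)) \<le> ennreal (real (card F) * v)"
  proof (rule nn_integral_PiM_split_le[OF Q JF])
    show "h \<in> borel_measurable (Pi\<^sub>M J (\<lambda>_. Q) \<Otimes>\<^sub>M Pi\<^sub>M F (\<lambda>_. Q))"
      unfolding h_def case_prod_beta' by measurable
    show "(\<integral>\<^sup>+e. h (d, e) \<partial>Pi\<^sub>M F (\<lambda>_. Q)) \<le> ennreal (real (card F) * v)" for d
    proof (cases "d \<in> G")
      case True
      then have "(\<integral>\<^sup>+e. h (d, e) \<partial>Pi\<^sub>M F (\<lambda>_. Q)) = ennreal (real (card F) * (LINT z|Q. (\<phi> d z)\<^sup>2))"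
        using nn_integral_PiM_sum_square[OF Q \<open>finite F\<close> int mean] by (simp add: h_def)
      with True var show ?thesis by (auto intro!: ennreal_leI mult_left_mono)
    qed (simp add: h_def)
  qed
  then show ?thesis
    by (simp add: h_def cong: sum.cong)
qed

text \<open>First-moment counterpart for summands without centring: the bound grows linearly in the
  fold size and no cancellation is used.\<close>

lemma nn_integral_PiM_nonneg_sum_le:
  fixes \<phi> :: "('i \<Rightarrow> 'a) \<Rightarrow> 'a \<Rightarrow> real"
  assumes Q: "prob_space Q" and JF: "J \<inter> F = {}" "finite J" "finite F"
    and [measurable]: "G \<in> sets (Pi\<^sub>M J (\<lambda>_. Q))"
      "(\<lambda>(d, z). \<phi> d z) \<in> borel_measurable (Pi\<^sub>M J (\<lambda>_. Q) \<Otimes>\<^sub>M Q)"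
    and nonneg: "\<And>d z. 0 \<le> \<phi> d z"
    and mean: "\<And>d. d \<in> G \<Longrightarrow> (\<integral>\<^sup>+z. ennreal (\<phi> d z) \<partial>Q) \<le> ennreal v"
  shows "(\<integral>\<^sup>+D. indicator G (restrict D J) * ennreal (\<Sum>i\<in>F. \<phi> (restrict D J) (D i))
    \<partial>Pi\<^sub>M (J \<union> F) (\<lambda>_. Q)) \<le> ennreal (real (card F) * v)"
proof -
  define h where "h = (\<lambda>(d, e). indicator G d * ennreal (\<Sum>i\<in>F. \<phi> d (e i)))"
  have [measurable]: "(\<lambda>p. \<phi> (fst p) (snd p i)) \<in> borel_measurable (Pi\<^sub>M J (\<lambda>_. Q) \<Otimes>\<^sub>M Pi\<^sub>M F (\<lambda>_. Q))"
    if "i \<in> F" for i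
  proof -
    have "(\<lambda>p. (fst p, snd p i)) \<in> Pi\<^sub>M J (\<lambda>_. Q) \<Otimes>\<^sub>M Pi\<^sub>M F (\<lambda>_. Q) \<rightarrow>\<^sub>M Pi\<^sub>M J (\<lambda>_. Q) \<Otimes>\<^sub>M Q"
      using that by measurable
    from measurable_compose[OF this assms(6)] show ?thesis by simp
  qed
  have "(\<integral>\<^sup>+D. h (restrict D J, restrict D F) \<partial>Pi\<^sub>M (J \<union> F) (\<lambda>_. Q)) \<le> ennreal (real (card F) * v)"
  proof (rule nn_integral_PiM_split_le[OF Q JF])
    show "h \<in> borel_measurable (Pi\<^sub>M J (\<lambda>_. Q) \<Otimes>\<^sub>M Pi\<^sub>M F (\<lambda>_. Q))"
      unfolding h_def case_prod_beta' by measurable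
    show "(\<integral>\<^sup>+e. h (d, e) \<partial>Pi\<^sub>M F (\<lambda>_. Q)) \<le> ennreal (real (card F) * v)"
      if d: "d \<in> space (Pi\<^sub>M J (\<lambda>_. Q))" for d
    proof (cases "d \<in> G")
      case True
      have "(\<lambda>z. ennreal (\<phi> d z)) \<in> borel_measurable Q"
        using measurable_Pair2[OF assms(6) d] by simp
      then have "(\<integral>\<^sup>+e. h (d, e) \<partial>Pi\<^sub>M F (\<lambda>_. Q)) = of_nat (card F) * (\<integral>\<^sup>+z. ennreal (\<phi> d z) \<partial>Q)"
        using nn_integral_PiM_sum[OF Q, of "\<lambda>z. ennreal (\<phi> d z)" F] True nonneg
        by (simp add: h_def sum_ennreal)
      also have "\<dots> \<le> of_nat (card F) * ennreal v"
        by (intro mult_left_mono mean True) simp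
      also have "\<dots> = ennreal (real (card F) * v)"
        by (simp add: ennreal_of_nat_eq_real_of_nat ennreal_mult')
      finally show ?thesis .
    qed (simp add: h_def)
  qed
  then show ?thesis
    by (simp add: h_def cong: sum.cong)
qed

lemma equal_foldsD:
  assumes "\<kappa> \<in> equal_folds N K" "k \<in> {1..K}"
  shows "\<kappa> k \<inter> train_idx N \<kappa> k = {}" "train_idx N \<kappa> k \<union> \<kappa> k = {1..N}" "card (\<kappa> k) = N div K"
    "finite (\<kappa> k)" "finite (train_idx N \<kappa> k)" "card (train_idx N \<kappa> k) = N - N div K"
    "train_idx N \<kappa> k \<subseteq> {1..N}" "\<kappa> k \<subseteq> {1..N}"
proof -
  show sub: "\<kappa> k \<subseteq> {1..N}" and c: "card (\<kappa> k) = N div K"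
    using assms by (auto simp: equal_folds_def)
  then show "finite (\<kappa> k)" by (auto intro: finite_subset)
  then show "card (train_idx N \<kappa> k) = N - N div K"
    using sub c by (simp add: train_idx_def card_Diff_subset)
qed (use assms in \<open>auto simp: train_idx_def equal_folds_def\<close>)

text \<open>One fixed sample size. All estimates below are non-asymptotic with explicit constants,
  so limits enter only in the final theorem. The number \<open>b\<close> is the constant value of
  the conditional labelling probability, later instantiated with \<open>pi_bar\<close>.\<close>

locale mcar_crossfit =
  Pop: basic_assumption P R Y X m \<mu> sigma1_sq sigma2_sq +
  crossfit_sample M P "\<lambda>u. observe (R N u) (Y u) (X u)" N K Z I
  for P :: "'u measure" and R Y and X :: "'u \<Rightarrow> real ^ 'p" and m \<mu> sigma1_sq sigma2_sq
    and M :: "'w measure" and N K Z I +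
  fixes L :: "'p learner" and b :: real
  assumes mcar: "AE u in P. cond_E P X (\<lambda>u. indicator {1} (R N u)) u = b"
    and b_pos: "0 < b" and N_pos: "0 < N" and K_ge_2: "2 \<le> K" and K_dvd_N: "K dvd N"
    and regression: "is_regression P X Y m" and mu_measurable: "\<mu> \<in> borel_measurable borel"
    and learner: "measurable_learner N L"
begin

section \<open>Moments of a single summand under MCAR\<close>

lemmas [measurable] = Pop.R_measurable Pop.Y_measurable Pop.X_measurable mu_measurable
  Pop.observe_measurable

lemmas mcar_nn_integral = Pop.mcar_nn_integral[OF mcar less_imp_le[OF b_pos]]
lemmas mcar_integral = Pop.mcar_integral[OF mcar less_imp_le[OF b_pos]]

lemma integral_obs_law:
  assumes "g \<in> borel_measurable borel"
  shows "(LINT z|obs_law. g z :: real) = (LINT u|P. g (observe (R N u) (Y u) (X u)))"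
  and "integrable obs_law g \<longleftrightarrow> integrable P (\<lambda>u. g (observe (R N u) (Y u) (X u)))"
  using assms by (auto simp: integral_distr integrable_distr_eq)

text \<open>The error made when \<open>f(X)\<close> is replaced by its inverse probability weighted
  version. It is used twice: with the fitting error as \<open>f\<close>, and with the constant 1,
  where it is the relative error of a label.\<close>

definition ipw_error :: "(real ^ 'p \<Rightarrow> real) \<Rightarrow> real \<times> real \<times> (real ^ 'p) \<Rightarrow> real" where
  "ipw_error f z = f (covariate z) * (1 - label z / b)"

text \<open>As \<open>R\<close> is binary, \<open>(R N u)\<^sup>2 = R N u\<close>, so the square is
  again linear in the label and MCAR evaluates it: the exact second moment is the squared norm of
  \<open>f\<close> times \<open>1 / b - 1\<close>.\<close>

lemma ipw_error_moments:
  assumes [measurable]: "f \<in> borel_measurable borel" and f2: "integrable P (\<lambda>u. (f (X u))\<^sup>2)"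
  shows "integrable obs_law (ipw_error f)" "integrable obs_law (\<lambda>z. (ipw_error f z)\<^sup>2)"
    "(LINT z|obs_law. ipw_error f z) = 0"
    "(LINT z|obs_law. (ipw_error f z)\<^sup>2) \<le> (LINT u|P. (f (X u))\<^sup>2) / b"
proof -
  have f1: "integrable P (\<lambda>u. f (X u))"
    using f2 by (rule Pop.square_integrable_imp_integrable[rotated]) auto
  \<comment> \<open>The independence statement \<open>mcar_integral\<close> concerns functions of
    the pair of outcome and covariate, so \<open>f\<close> is lifted to pairs.\<close>
  have m1: "(\<lambda>p::real \<times> (real ^ 'p). f (snd p)) \<in> borel_measurable borel"
    unfolding borel_prod[symmetric] by measurable
  have m2: "(\<lambda>p::real \<times> (real ^ 'p). (f (snd p))\<^sup>2) \<in> borel_measurable borel"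
    unfolding borel_prod[symmetric] by measurable
  note Rf = mcar_integral[OF m1, simplified, OF f1]
  note Rf2 = mcar_integral[OF m2, simplified, OF f2]
  have [measurable]: "ipw_error f \<in> borel_measurable borel"
    unfolding ipw_error_def by measurable
  have e: "ipw_error f (observe (R N u) (Y u) (X u)) = f (X u) - (R N u * f (X u)) / b" for u
    by (simp add: ipw_error_def algebra_simps)
  have e2: "(ipw_error f (observe (R N u) (Y u) (X u)))\<^sup>2
      = (f (X u))\<^sup>2 + (R N u * (f (X u))\<^sup>2) * (1 / b\<^sup>2 - 2 / b)" if "u \<in> space P" for u
  proof -
    have "(ipw_error f (observe (R N u) (Y u) (X u)))\<^sup>2
      = (f (X u))\<^sup>2 + ((R N u)\<^sup>2 * (f (X u))\<^sup>2) / b\<^sup>2 - 2 * (R N u * (f (X u))\<^sup>2) / b"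
      unfolding e by (simp add: power2_eq_square algebra_simps)
    then show ?thesis using Pop.R_square[OF that, of N] by (simp add: algebra_simps)
  qed
  show "integrable obs_law (ipw_error f)"
    using f1 Rf by (subst integral_obs_law) (auto simp: e)
  show "(LINT z|obs_law. ipw_error f z) = 0"
    using f1 Rf b_pos by (subst integral_obs_law) (auto simp: e)
  have i: "integrable P (\<lambda>u. (f (X u))\<^sup>2 + (R N u * (f (X u))\<^sup>2) * (1 / b\<^sup>2 - 2 / b))"
    using f2 Rf2 by simp
  then show "integrable obs_law (\<lambda>z. (ipw_error f z)\<^sup>2)"
    by (subst integral_obs_law) (auto simp: e2 cong: Bochner_Integration.integrable_cong)
  have "(LINT z|obs_law. (ipw_error f z)\<^sup>2)
      = (LINT u|P. (f (X u))\<^sup>2 + (R N u * (f (X u))\<^sup>2) * (1 / b\<^sup>2 - 2 / b))"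
    by (subst integral_obs_law) (auto simp: e2 cong: Bochner_Integration.integral_cong)
  also have "\<dots> = (LINT u|P. (f (X u))\<^sup>2) * (1 + b * (1 / b\<^sup>2 - 2 / b))"
    using f2 Rf2 by (simp add: algebra_simps)
  also have "1 + b * (1 / b\<^sup>2 - 2 / b) = 1 / b - 1"
    using b_pos by (simp add: field_simps power2_eq_square)
  also have "(LINT u|P. (f (X u))\<^sup>2) * (1 / b - 1) \<le> (LINT u|P. (f (X u))\<^sup>2) / b"
    by (simp add: algebra_simps)
  finally show "(LINT z|obs_law. (ipw_error f z)\<^sup>2) \<le> (LINT u|P. (f (X u))\<^sup>2) / b" .
qed

abbreviation "\<Delta> \<equiv> Delta_mu P X m \<mu>"

text \<open>The weighted residual has mean \<open>- \<Delta>\<close>, and adding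
  \<open>\<Delta>\<close> centres it. The product of label and outcome is read off as one coordinate
  because the law of an observation knows the outcome only in this form.\<close>

definition resid :: "real \<times> real \<times> (real ^ 'p) \<Rightarrow> real" where
  "resid z = (labelled_outcome z - label z * \<mu> (covariate z)) / b + \<Delta>"

definition "resid_var = (LINT u|P. (Y u - \<mu> (X u))\<^sup>2)"

text \<open>By the tower property m(X) and Y have the same mean, so \<Delta>, defined through the
  regression function, is also the mean of \<mu>(X) - Y.\<close>

lemma Delta_eq: "integrable P (\<lambda>u. Y u - \<mu> (X u))" "(LINT u|P. Y u - \<mu> (X u)) = - \<Delta>"
proof -
  show e: "integrable P (\<lambda>u. Y u - \<mu> (X u))"
    using Pop.Y_mu_square_integrable by (rule Pop.square_integrable_imp_integrable[rotated]) auto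
  have Y: "integrable P Y"
    using Pop.Y_square_integrable by (rule Pop.square_integrable_imp_integrable[rotated]) auto
  have mu: "integrable P (\<lambda>u. \<mu> (X u))"
    using Bochner_Integration.integrable_diff[OF Y e] by simp
  interpret F: finite_measure_subalgebra P "vimage_algebra (space P) X borel"
    by (rule Pop.vimage_subalgebra) measurable
  have [measurable]: "m \<in> borel_measurable borel" and "AE u in P. m (X u) = cond_E P X Y u"
    using regression by (auto simp: is_regression_def)
  note ae = this(2)[unfolded cond_E_def]
  have m: "integrable P (\<lambda>u. m (X u))"
    using F.real_cond_exp_int(1)[OF Y] integrable_cong_AE[OF _ _ ae] by simp
  have "(LINT u|P. m (X u)) = (LINT u|P. Y u)"
    using F.real_cond_exp_int(2)[OF Y] integral_cong_AE[OF _ _ ae] by simp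
  then show "(LINT u|P. Y u - \<mu> (X u)) = - \<Delta>"
    using Y mu m by (simp add: Delta_mu_def)
qed

lemma resid_moments:
  shows "integrable obs_law resid" "integrable obs_law (\<lambda>z. (resid z)\<^sup>2)"
    "(LINT z|obs_law. resid z) = 0" "(LINT z|obs_law. (resid z)\<^sup>2) \<le> resid_var / b"
proof -
  let ?e = "\<lambda>u. Y u - \<mu> (X u)"
  have m1: "(\<lambda>p::real \<times> (real ^ 'p). fst p - \<mu> (snd p)) \<in> borel_measurable borel"
    unfolding borel_prod[symmetric] by measurable
  have m2: "(\<lambda>p::real \<times> (real ^ 'p). (fst p - \<mu> (snd p))\<^sup>2) \<in> borel_measurable borel"
    unfolding borel_prod[symmetric] by measurable
  note Re = mcar_integral[OF m1, unfolded fst_conv snd_conv, OF Delta_eq(1), unfolded Delta_eq(2)]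
  note Re2 = mcar_integral[OF m2, unfolded fst_conv snd_conv, OF Pop.Y_mu_square_integrable,
      folded resid_var_def]
  have [measurable]: "resid \<in> borel_measurable borel"
    unfolding resid_def by measurable
  have e: "resid (observe (R N u) (Y u) (X u)) = R N u * ?e u / b + \<Delta>" for u
    by (simp add: resid_def algebra_simps)
  have e2: "(resid (observe (R N u) (Y u) (X u)))\<^sup>2
      = (R N u * (?e u)\<^sup>2) / b\<^sup>2 + \<Delta>\<^sup>2 + (R N u * ?e u) * (2 * \<Delta> / b)" if "u \<in> space P" for u
  proof -
    have "(resid (observe (R N u) (Y u) (X u)))\<^sup>2
      = ((R N u)\<^sup>2 * (?e u)\<^sup>2) / b\<^sup>2 + \<Delta>\<^sup>2 + (R N u * ?e u) * (2 * \<Delta> / b)"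
      unfolding e by (simp add: power2_sum power_mult_distrib power_divide)
    then show ?thesis using Pop.R_square[OF that, of N] by simp
  qed
  show "integrable obs_law resid"
    using Re by (subst integral_obs_law) (auto simp: e)
  show "(LINT z|obs_law. resid z) = 0"
    using Re b_pos by (subst integral_obs_law) (auto simp: e Pop.prob_space)
  have i: "integrable P (\<lambda>u. (R N u * (?e u)\<^sup>2) / b\<^sup>2 + \<Delta>\<^sup>2 + (R N u * ?e u) * (2 * \<Delta> / b))"
    using Re(1) Re2(1) by simp
  then show "integrable obs_law (\<lambda>z. (resid z)\<^sup>2)"
    by (subst integral_obs_law) (auto simp: e2 cong: Bochner_Integration.integrable_cong)
  have "(LINT z|obs_law. (resid z)\<^sup>2)
      = (LINT u|P. (R N u * (?e u)\<^sup>2) / b\<^sup>2 + \<Delta>\<^sup>2 + (R N u * ?e u) * (2 * \<Delta> / b))"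
    by (subst integral_obs_law) (auto simp: e2 cong: Bochner_Integration.integral_cong)
  \<comment> \<open>The cross term has mean \<open>- 2 * \<Delta>\<^sup>2\<close>, which outweighs
    the constant \<open>\<Delta>\<^sup>2\<close>.\<close>
  also have "\<dots> = resid_var / b - \<Delta>\<^sup>2"
    using Re Re2 b_pos by (simp add: Pop.prob_space power2_eq_square)
  also have "\<dots> \<le> resid_var / b" by simp
  finally show "(LINT z|obs_law. (resid z)\<^sup>2) \<le> resid_var / b" .
qed

text \<open>The L1 norm of \<open>f(X)\<close> is bounded through the L2 norm by the pointwise
  inequality \<open>\<bar>f\<bar> \<le> (f\<^sup>2 / \<delta> + \<delta>) / 2\<close>, and MCAR
  contributes the factor \<open>b\<close>. That factor later cancels the \<open>1 / b\<close> in
  front of the labelled fitting error.\<close>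

lemma labelled_abs_moment:
  assumes [measurable]: "f \<in> borel_measurable borel" and f2: "integrable P (\<lambda>u. (f (X u))\<^sup>2)"
    and le: "(LINT u|P. (f (X u))\<^sup>2) \<le> \<delta>\<^sup>2" and "0 < \<delta>"
  shows "(\<integral>\<^sup>+z. ennreal \<bar>label z * f (covariate z)\<bar> \<partial>obs_law) \<le> ennreal (b * \<delta>)"
proof -
  have f1: "integrable P (\<lambda>u. f (X u))"
    using f2 by (rule Pop.square_integrable_imp_integrable[rotated]) auto
  have "(LINT u|P. \<bar>f (X u)\<bar>) \<le> (LINT u|P. ((f (X u))\<^sup>2 / \<delta> + \<delta>) / 2)"
  proof (rule integral_mono)
    fix u
    have "0 \<le> (\<bar>f (X u)\<bar> - \<delta>)\<^sup>2" by simp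
    then have "2 * \<delta> * \<bar>f (X u)\<bar> \<le> (f (X u))\<^sup>2 + \<delta>\<^sup>2" by (simp add: power2_diff algebra_simps)
    then show "\<bar>f (X u)\<bar> \<le> ((f (X u))\<^sup>2 / \<delta> + \<delta>) / 2"
      using \<open>0 < \<delta>\<close> by (simp add: field_simps power2_eq_square)
  qed (use f1 f2 in auto)
  also have "(LINT u|P. ((f (X u))\<^sup>2 / \<delta> + \<delta>) / 2) = ((LINT u|P. (f (X u))\<^sup>2) / \<delta> + \<delta>) / 2"
    using f2 by (simp add: Pop.prob_space)
  also have "\<dots> \<le> (\<delta>\<^sup>2 / \<delta> + \<delta>) / 2"
    using le \<open>0 < \<delta>\<close> by (intro divide_right_mono add_right_mono) auto
  also have "\<dots> = \<delta>" using \<open>0 < \<delta>\<close> by (simp add: power2_eq_square)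
  finally have "(LINT u|P. \<bar>f (X u)\<bar>) \<le> \<delta>" .
  note bound = ennreal_leI[OF this]
  have "(\<integral>\<^sup>+z. ennreal \<bar>label z * f (covariate z)\<bar> \<partial>obs_law)
      = (\<integral>\<^sup>+u. ennreal \<bar>R N u * f (X u)\<bar> \<partial>P)"
    by (subst nn_integral_distr) auto
  also have "\<dots> = (\<integral>\<^sup>+u. ennreal (R N u) * ennreal \<bar>f (X u)\<bar> \<partial>P)"
    using Pop.R_nonneg by (intro nn_integral_cong) (auto simp: abs_mult ennreal_mult)
  also have "\<dots> = ennreal b * (\<integral>\<^sup>+u. ennreal \<bar>f (X u)\<bar> \<partial>P)"
    by (rule mcar_nn_integral[of "\<lambda>p. ennreal \<bar>f (snd p)\<bar>", simplified])
       (unfold borel_prod[symmetric], measurable)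
  also have "(\<integral>\<^sup>+u. ennreal \<bar>f (X u)\<bar> \<partial>P) = ennreal (LINT u|P. \<bar>f (X u)\<bar>)"
    using f1 by (intro nn_integral_eq_integral) auto
  also have "ennreal b * \<dots> \<le> ennreal b * ennreal \<delta>"
    by (intro mult_left_mono bound) simp
  finally show ?thesis
    using b_pos by (simp add: ennreal_mult')
qed

end

subsection \<open>Algebra of the remainder\<close>

lemma sum_equal_folds:
  fixes g :: "nat \<Rightarrow> real" and J :: "nat \<Rightarrow> nat set"
  assumes "disjoint_family_on J {1..K}" "(\<Union>k\<in>{1..K}. J k) = {1..N}"
  shows "(\<Sum>i=1..N. g i) = (\<Sum>k=1..K. \<Sum>i\<in>J k. g i)"
proof -
  have "finite (J k)" if "k \<in> {1..K}" for k
    using that assms(2) by (metis UN_upper finite_atLeastAtMost finite_subset)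
  then show ?thesis
    unfolding assms(2)[symmetric] using assms(1)
    by (intro sum.UNION_disjoint) (auto simp: disjoint_family_on_def)
qed

lemma fold_of_eq:
  assumes "disjoint_family_on J {1..K}" "k \<in> {1..K}" "i \<in> J k"
  shows "fold_of K J i = k"
  unfolding fold_of_def using assms unfolding disjoint_family_on_def by (intro the_equality) blast+

text \<open>The folds have equal size, so every observation enters \<open>K - 1\<close> of the \<open>K\<close> training sets.
  This is what makes the first-order error of the estimated propensities sum to the
  \<open>IF_pi\<close> term.\<close>

lemma sum_train_means:
  fixes g :: "nat \<Rightarrow> real"
  assumes J: "disjoint_family_on J {1..K}" "(\<Union>k\<in>{1..K}. J k) = {1..N}"
    and card: "\<And>k. k \<in> {1..K} \<Longrightarrow> card (J k) = n" and N: "N = K * n" "0 < n" "2 \<le> K"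
  shows "real n * (\<Sum>k=1..K. (\<Sum>j\<in>train_idx N J k. g j) / card (train_idx N J k)) = (\<Sum>i=1..N. g i)"
proof -
  have sub: "J k \<subseteq> {1..N}" if "k \<in> {1..K}" for k using that J(2) by blast
  have "card (train_idx N J k) = (K - 1) * n" if "k \<in> {1..K}" for k
    using sub[OF that] card[OF that] N
    by (simp add: train_idx_def card_Diff_subset finite_subset[OF sub[OF that]] diff_mult_distrib)
  moreover have "(\<Sum>j\<in>train_idx N J k. g j) = (\<Sum>i=1..N. g i) - (\<Sum>i\<in>J k. g i)" if "k \<in> {1..K}" for k
    unfolding train_idx_def using sub[OF that] by (intro sum_diff) auto
  ultimately have "(\<Sum>k=1..K. (\<Sum>j\<in>train_idx N J k. g j) / card (train_idx N J k))
      = (\<Sum>k=1..K. ((\<Sum>i=1..N. g i) - (\<Sum>i\<in>J k. g i)) / real ((K - 1) * n))"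
    by (intro sum.cong) auto
  also have "\<dots> = (real K * (\<Sum>i=1..N. g i) - (\<Sum>i=1..N. g i)) / real ((K - 1) * n)"
    unfolding sum_divide_distrib[symmetric] sum_subtractf sum_equal_folds[OF J, symmetric] by simp
  also have "\<dots> = (\<Sum>i=1..N. g i) * ((real K - 1) / real ((K - 1) * n))"
    by (simp add: algebra_simps)
  also have "(real K - 1) / real ((K - 1) * n) = 1 / n"
    using N by (simp add: of_nat_diff)
  finally show ?thesis using N by simp
qed

text \<open>A deterministic identity. The last term pairs \<open>b / p k - 1\<close> with
  \<open>p k / b - 1\<close> for the same fold: their first-order parts are opposite, so only a
  quadratic error is left to estimate.\<close>

lemma DRSS_remainder_eq:
  fixes \<mu> :: "'x \<Rightarrow> real" and r y :: "nat \<Rightarrow> real" and x :: "nat \<Rightarrow> 'x" and p :: "nat \<Rightarrow> real"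
  assumes J: "disjoint_family_on J {1..K}" "(\<Union>k\<in>{1..K}. J k) = {1..N}"
    and card: "\<And>k. k \<in> {1..K} \<Longrightarrow> card (J k) = n" and N: "N = K * n" "0 < n" "2 \<le> K"
    and b: "0 < b" and p: "\<And>k (z :: 'x). k \<in> {1..K} \<Longrightarrow> pi_hat N J r k z = p k" "\<And>k. k \<in> {1..K} \<Longrightarrow> 0 < p k"
  shows "theta_DRSS K N J mh (pi_hat N J r) r y x - \<theta>0
      - (1 / real N) * (\<Sum>i=1..N. psi_mu \<mu> b \<theta>0 (r i) (y i) (x i) + IF_pi b \<Delta> (r i))
    = (1 / real N) * (\<Sum>k=1..K.
        (\<Sum>i\<in>J k. (mh k (x i) - \<mu> (x i)) * (1 - r i / b))
        - (b / p k - 1) / b * (\<Sum>i\<in>J k. r i * (mh k (x i) - \<mu> (x i)))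
        + (b / p k - 1) * (\<Sum>i\<in>J k. (r i * y i - r i * \<mu> (x i)) / b + \<Delta>)
        - \<Delta> * (real n * ((b / p k - 1) + (p k / b - 1))))"
proof -
  define f where "f k i = mh k (x i) - \<mu> (x i)" for k i
  define w where "w i = (r i * y i - r i * \<mu> (x i)) / b + \<Delta>" for i
  have N0: "0 < real N" using N by simp
  have "theta_DRSS K N J mh (pi_hat N J r) r y x
      = (1 / real N) * (\<Sum>k=1..K. \<Sum>i\<in>J k. mh k (x i) + r i / p k * (y i - mh k (x i)))"
    unfolding theta_DRSS_def Let_def sum_equal_folds[OF J]
  proof (intro arg_cong2[where f = "(*)"] sum.cong refl)
    fix k i assume "k \<in> {1..K}" "i \<in> J k"
    then show "mh (fold_of K J i) (x i)
        + r i / pi_hat N J r (fold_of K J i) (x i) * (y i - mh (fold_of K J i) (x i))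
      = mh k (x i) + r i / p k * (y i - mh k (x i))"
      by (simp only: fold_of_eq[OF J(1)] p(1))
  qed
  moreover have "\<theta>0 = (1 / real N) * (\<Sum>k=1..K. \<Sum>i\<in>J k. \<theta>0)"
    using N0 unfolding sum_equal_folds[OF J, symmetric] by simp
  moreover have "(\<Sum>i=1..N. psi_mu \<mu> b \<theta>0 (r i) (y i) (x i) + IF_pi b \<Delta> (r i))
      = (\<Sum>k=1..K. \<Sum>i\<in>J k. psi_mu \<mu> b \<theta>0 (r i) (y i) (x i) + IF_pi b \<Delta> (r i))"
    by (rule sum_equal_folds[OF J])
  ultimately have "theta_DRSS K N J mh (pi_hat N J r) r y x - \<theta>0
      - (1 / real N) * (\<Sum>i=1..N. psi_mu \<mu> b \<theta>0 (r i) (y i) (x i) + IF_pi b \<Delta> (r i))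
    = (1 / real N) * (\<Sum>k=1..K. \<Sum>i\<in>J k. mh k (x i) + r i / p k * (y i - mh k (x i)) - \<theta>0
        - (psi_mu \<mu> b \<theta>0 (r i) (y i) (x i) + IF_pi b \<Delta> (r i)))"
    by (simp only: sum_subtractf right_diff_distrib)
  \<comment> \<open>With \<rho> = b / p - 1, write 1 / p = (1 + \<rho>) / b and mh = \<mu> + f, then
    add and subtract \<rho> \<Delta> to centre the residual.\<close>
  also have "(\<Sum>k=1..K. \<Sum>i\<in>J k. mh k (x i) + r i / p k * (y i - mh k (x i)) - \<theta>0
        - (psi_mu \<mu> b \<theta>0 (r i) (y i) (x i) + IF_pi b \<Delta> (r i)))
    = (\<Sum>k=1..K. \<Sum>i\<in>J k. f k i * (1 - r i / b) - (b / p k - 1) / b * (r i * f k i)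
        + (b / p k - 1) * w i - \<Delta> * (b / p k - 1) - \<Delta> * (r i / b - 1))"
  proof (intro sum.cong refl)
    fix k i assume "k \<in> {1..K}"
    then have "0 < p k" by (rule p)
    then show "mh k (x i) + r i / p k * (y i - mh k (x i)) - \<theta>0
        - (psi_mu \<mu> b \<theta>0 (r i) (y i) (x i) + IF_pi b \<Delta> (r i))
      = f k i * (1 - r i / b) - (b / p k - 1) / b * (r i * f k i)
        + (b / p k - 1) * w i - \<Delta> * (b / p k - 1) - \<Delta> * (r i / b - 1)"
      using b unfolding f_def w_def psi_mu_def IF_pi_def by (simp add: field_simps)
  qed
  also have "\<dots> = (\<Sum>k=1..K. (\<Sum>i\<in>J k. f k i * (1 - r i / b)) - (b / p k - 1) / b * (\<Sum>i\<in>J k. r i * f k i)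
        + (b / p k - 1) * (\<Sum>i\<in>J k. w i) - \<Delta> * (real n * (b / p k - 1)))
        - \<Delta> * (\<Sum>i=1..N. r i / b - 1)"
    unfolding sum_equal_folds[OF J] sum_distrib_left sum_subtractf[symmetric]
    by (intro sum.cong refl) (simp add: sum_subtractf sum.distrib sum_distrib_left card)
  \<comment> \<open>The overall label frequency is traded for the training frequencies, so that each
    fold receives its own linear term.\<close>
  also have "(\<Sum>i=1..N. r i / b - 1) = (\<Sum>k=1..K. real n * (p k / b - 1))"
  proof -
    have "(\<Sum>i=1..N. r i) = real n * (\<Sum>k=1..K. p k)"
      using sum_train_means[OF J card N, of r] p(1)[unfolded pi_hat_def] by simp
    then show ?thesis
      using N by (simp add: sum_subtractf sum_divide_distrib[symmetric] sum_distrib_left[symmetric] algebra_simps)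
  qed
  finally show ?thesis
    unfolding f_def w_def by (simp add: sum_subtractf[symmetric] sum_distrib_left algebra_simps)
qed

text \<open>Here b / p - 1 = - q / (1 + q), and adding q leaves q^2 / (1 + q). The constants 2 come
  from 1 + q being at least 1/2.\<close>

lemma inverse_ratio_bounds:
  fixes q :: real
  assumes "\<bar>q\<bar> \<le> 1/2" "p = b * (1 + q)" "0 < b"
  shows "\<bar>b / p - 1\<bar> \<le> 2 * \<bar>q\<bar>" "\<bar>(b / p - 1) + q\<bar> \<le> 2 * q\<^sup>2"
proof -
  have q: "1/2 \<le> 1 + q" using assms by linarith
  have "b / p = 1 / (1 + q)" using assms by simp
  also have "1 / (1 + q) - 1 = - q / (1 + q)" using q by (simp add: field_simps)
  finally have e: "b / p - 1 = - q / (1 + q)" .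
  have "\<bar>q\<bar> / (1 + q) \<le> \<bar>q\<bar> / (1/2)"
    using q by (intro divide_left_mono) auto
  then show "\<bar>b / p - 1\<bar> \<le> 2 * \<bar>q\<bar>" using q by (simp add: e abs_divide)
  have e': "(b / p - 1) + q = q\<^sup>2 / (1 + q)"
    unfolding e using q by (simp add: field_simps power2_eq_square)
  have "q\<^sup>2 / (1 + q) \<le> q\<^sup>2 / (1/2)"
    using q by (intro divide_left_mono) auto
  then show "\<bar>(b / p - 1) + q\<bar> \<le> 2 * q\<^sup>2" unfolding e' using q by simp
qed

text \<open>\<open>W\<close> is the target rate \<open>(N * b) powr (-1/2)\<close> times
  \<open>sqrt H\<close>, where \<open>H\<close> is the slack in Markov's inequality. After division
  by \<open>N * W\<close>, every term carries either \<delta>, the quality of the fit, or a further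
  factor \<open>W\<close>; both can be made small once \<open>H\<close> is fixed. The threshold 1/4
  keeps \<open>\<bar>q\<bar> \<le> 1/2\<close>.\<close>

lemma DRSS_fold_remainder_le:
  fixes q :: real
  assumes b: "0 < b" and n: "0 \<le> n" "n \<le> N" "0 < N" and H: "0 \<le> H" and \<delta>: "0 \<le> \<delta>" and s: "0 \<le> s"
    and p: "p = b * (1 + q)" and q: "q\<^sup>2 \<le> 2 * H / (N * b)" and small: "2 * H / (N * b) \<le> 1/4"
    and A: "A\<^sup>2 \<le> n * (\<delta>\<^sup>2 / b) * H" and C: "\<bar>C\<bar> \<le> n * (b * \<delta>) * H" and B: "B\<^sup>2 \<le> n * (s / b) * H"
    and W: "W = sqrt (H / (N * b))"
  shows "\<bar>A - (b / p - 1) / b * C + (b / p - 1) * B - \<Delta> * (n * ((b / p - 1) + (p / b - 1)))\<bar>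
    \<le> N * (W * (\<delta> * (1 + 4 * H) + 4 * W * (sqrt s + \<bar>\<Delta>\<bar>)))"
proof -
  have W0: "0 \<le> W" and W2: "W\<^sup>2 = H / (N * b)"
    using W b n H by auto
  have q2: "\<bar>q\<bar> \<le> 2 * W"
  proof (rule power2_le_imp_le)
    have "0 \<le> W\<^sup>2" by simp
    moreover have "q\<^sup>2 \<le> 2 * W\<^sup>2" using q W2 by simp
    moreover have "(2 * W)\<^sup>2 = 4 * W\<^sup>2" by (simp add: power_mult_distrib)
    ultimately show "\<bar>q\<bar>\<^sup>2 \<le> (2 * W)\<^sup>2" unfolding power2_abs by linarith
  qed (use W0 in simp)
  have "q\<^sup>2 \<le> (1/2)\<^sup>2" using q small by (simp add: power2_eq_square)
  then have qh: "\<bar>q\<bar> \<le> 1/2" using power2_le_iff_abs_le[of "1/2" q] by simp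
  note rho = inverse_ratio_bounds[OF qh p b]
  have pq: "p / b - 1 = q" using p b by simp
  have rho4: "\<bar>b / p - 1\<bar> \<le> 4 * W" using rho(1) q2 by linarith
  \<comment> \<open>Both centred sums have a bound of this shape: \<open>t = \<delta>\<close> for
    the fitting error and \<open>t = sqrt s\<close> for the residuals. The fold size is enlarged to
    \<open>N\<close>.\<close>
  have root: "\<bar>T\<bar> \<le> N * (W * t)" if "T\<^sup>2 \<le> n * (t\<^sup>2 / b) * H" "0 \<le> t" for T t
  proof (rule power2_le_imp_le)
    note that(1)
    also have "n * (t\<^sup>2 / b) * H \<le> N * (t\<^sup>2 / b) * H"
      using n b H by (intro mult_right_mono) auto
    also have "\<dots> = (N * (W * t))\<^sup>2"
    proof -
      have HW: "H = W\<^sup>2 * (N * b)" using W2 n b by simp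
      show ?thesis unfolding HW using n b by (simp add: field_simps power2_eq_square)
    qed
    finally show "\<bar>T\<bar>\<^sup>2 \<le> (N * (W * t))\<^sup>2" by simp
  qed (use n W0 that in simp)
  have A': "\<bar>A\<bar> \<le> N * (W * \<delta>)" using root[OF A \<delta>] .
  have B': "\<bar>B\<bar> \<le> N * (W * sqrt s)" using root[of B "sqrt s"] B s by simp
  have "\<bar>C\<bar> / b \<le> n * \<delta> * H" using C b by (simp add: field_simps)
  also have "\<dots> \<le> N * (\<delta> * H)" using n \<delta> H by (simp add: mult_right_mono mult.assoc)
  finally have C': "\<bar>C\<bar> / b \<le> N * (\<delta> * H)" .
  have "\<bar>(b / p - 1) / b * C\<bar> = \<bar>b / p - 1\<bar> * (\<bar>C\<bar> / b)" using b by (simp add: abs_mult)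
  also have "\<dots> \<le> (4 * W) * (N * (\<delta> * H))"
    using rho4 C' W0 b by (intro mult_mono) auto
  finally have T2: "\<bar>(b / p - 1) / b * C\<bar> \<le> (4 * W) * (N * (\<delta> * H))" .
  have T3: "\<bar>(b / p - 1) * B\<bar> \<le> (4 * W) * (N * (W * sqrt s))"
    unfolding abs_mult using rho4 B' W0 by (intro mult_mono) auto
  have "\<bar>\<Delta> * (n * ((b / p - 1) + (p / b - 1)))\<bar> = \<bar>\<Delta>\<bar> * (n * \<bar>(b / p - 1) + q\<bar>)"
    using n unfolding pq by (simp add: abs_mult)
  also have "\<dots> \<le> \<bar>\<Delta>\<bar> * (N * (4 * W\<^sup>2))"
  proof (intro mult_left_mono mult_mono)
    show "\<bar>(b / p - 1) + q\<bar> \<le> 4 * W\<^sup>2" using rho(2) q W2 by simp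
  qed (use n in auto)
  finally have T4: "\<bar>\<Delta> * (n * ((b / p - 1) + (p / b - 1)))\<bar> \<le> \<bar>\<Delta>\<bar> * (N * (4 * W\<^sup>2))" .
  have "\<bar>A - (b / p - 1) / b * C + (b / p - 1) * B - \<Delta> * (n * ((b / p - 1) + (p / b - 1)))\<bar>
    \<le> N * (W * \<delta>) + (4 * W) * (N * (\<delta> * H)) + (4 * W) * (N * (W * sqrt s)) + \<bar>\<Delta>\<bar> * (N * (4 * W\<^sup>2))"
    using A' T2 T3 T4 by linarith
  also have "\<dots> = N * (W * (\<delta> * (1 + 4 * H) + 4 * W * (sqrt s + \<bar>\<Delta>\<bar>)))"
    by (simp add: algebra_simps power2_eq_square)
  finally show ?thesis .
qed

subsection \<open>Stochastic bounds\<close>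

context mcar_crossfit
begin

lemma sets_obs_law: "sets (Pi\<^sub>M J (\<lambda>_. obs_law)) = sets (Pi\<^sub>M J (\<lambda>_. borel))"
  by (intro sets_PiM_cong) auto

lemma sum_train_measurable:
  fixes \<phi> :: "(nat \<Rightarrow> real \<times> real \<times> (real ^ 'p)) \<Rightarrow> real \<times> real \<times> (real ^ 'p) \<Rightarrow> real"
  assumes \<phi>: "(\<lambda>(d, z). \<phi> d z) \<in> borel_measurable (Pi\<^sub>M J (\<lambda>_. borel) \<Otimes>\<^sub>M borel)"
    and "J \<subseteq> {1..N}" "F \<subseteq> {1..N}"
  shows "(\<lambda>D. \<Sum>i\<in>F. \<phi> (restrict D J) (D i)) \<in> borel_measurable (Pi\<^sub>M {1..N} (\<lambda>_. borel))"
proof (rule borel_measurable_sum)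
  fix i assume "i \<in> F"
  then have "i \<in> {1..N}" using assms by auto
  then have "(\<lambda>D. (restrict D J, D i)) \<in> Pi\<^sub>M {1..N} (\<lambda>_. borel) \<rightarrow>\<^sub>M Pi\<^sub>M J (\<lambda>_. borel) \<Otimes>\<^sub>M borel"
    by (intro measurable_Pair measurable_restrict_subset measurable_component_singleton assms)
  from measurable_compose[OF this \<phi>]
  show "(\<lambda>D. \<phi> (restrict D J) (D i)) \<in> borel_measurable (Pi\<^sub>M {1..N} (\<lambda>_. borel))" by simp
qed

text \<open>Markov's inequality at \<open>H\<close> times the mean bound \<open>c\<close>, whence
  probability \<open>1 / H\<close>. Membership in \<open>G\<close> remains a premise of the
  conclusion, so the chance of leaving \<open>G\<close> can be charged separately. \<open>T\<close>
  is the square for centred sums and the identity for nonnegative ones; \<open>J\<close> is frozen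
  and \<open>F\<close> is summed over.\<close>

lemma prob_fold_sum_gt:
  fixes \<phi> :: "(nat \<Rightarrow> nat set) \<Rightarrow> (nat \<Rightarrow> real \<times> real \<times> (real ^ 'p)) \<Rightarrow> real \<times> real \<times> (real ^ 'p) \<Rightarrow> real"
    and T :: "real \<Rightarrow> real"
  assumes [measurable]: "T \<in> borel_measurable borel" and "0 < c" "0 < H"
    and JF: "\<And>\<kappa>. \<kappa> \<in> equal_folds N K \<Longrightarrow> J \<kappa> \<subseteq> {1..N}" "\<And>\<kappa>. \<kappa> \<in> equal_folds N K \<Longrightarrow> F \<kappa> \<subseteq> {1..N}"
    and G: "\<And>\<kappa>. \<kappa> \<in> equal_folds N K \<Longrightarrow> G \<kappa> \<in> sets (Pi\<^sub>M (J \<kappa>) (\<lambda>_. borel))"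
    and \<phi>: "\<And>\<kappa>. \<kappa> \<in> equal_folds N K \<Longrightarrow>
      (\<lambda>(d, z). \<phi> \<kappa> d z) \<in> borel_measurable (Pi\<^sub>M (J \<kappa>) (\<lambda>_. borel) \<Otimes>\<^sub>M borel)"
    and le: "\<And>\<kappa>. \<kappa> \<in> equal_folds N K \<Longrightarrow>
      (\<integral>\<^sup>+D. indicator (G \<kappa>) (restrict D (J \<kappa>)) *
        ennreal (T (\<Sum>i\<in>F \<kappa>. \<phi> \<kappa> (restrict D (J \<kappa>)) (D i))) \<partial>Pi\<^sub>M {1..N} (\<lambda>_. obs_law)) \<le> ennreal c"
  shows "\<exists>E\<in>events. prob E \<le> 1 / H \<and> (\<forall>\<omega>\<in>space M - E.
    restrict (data \<omega>) (J (folds \<omega>)) \<in> G (folds \<omega>) \<longrightarrow>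
    T (\<Sum>i\<in>F (folds \<omega>). \<phi> (folds \<omega>) (restrict (data \<omega>) (J (folds \<omega>))) (data \<omega> i)) \<le> c * H)"
proof -
  define h where "h \<kappa> D = indicator (G \<kappa>) (restrict D (J \<kappa>)) *
    ennreal (T (\<Sum>i\<in>F \<kappa>. \<phi> \<kappa> (restrict D (J \<kappa>)) (D i)))" for \<kappa> D
  have hm: "h \<kappa> \<in> borel_measurable (Pi\<^sub>M {1..N} (\<lambda>_. borel))" if k: "\<kappa> \<in> equal_folds N K" for \<kappa>
  proof -
    note [measurable] = sum_train_measurable[OF \<phi>[OF k] JF(1)[OF k] JF(2)[OF k]] G[OF k]
    have [measurable]: "(\<lambda>D. restrict D (J \<kappa>)) \<in> Pi\<^sub>M {1..N} (\<lambda>_. borel) \<rightarrow>\<^sub>M Pi\<^sub>M (J \<kappa>) (\<lambda>_. borel)"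
      by (rule measurable_restrict_subset) (rule JF(1)[OF k])
    show ?thesis unfolding h_def by measurable
  qed
  let ?E = "{\<omega> \<in> space M. h (folds \<omega>) (data \<omega>) > ennreal (c * H)}"
  have [measurable]: "(\<lambda>\<omega>. h (folds \<omega>) (data \<omega>)) \<in> borel_measurable M"
    by (rule measurable_folds_data) (rule hm)
  have "?E \<in> events" by measurable
  moreover have "prob ?E \<le> c / (c * H)"
    by (rule prob_folds_data_Markov[OF N_pos _ _ hm]) (use assms(2,3) le in \<open>simp_all add: h_def\<close>)
  moreover have "T (\<Sum>i\<in>F (folds \<omega>). \<phi> (folds \<omega>) (restrict (data \<omega>) (J (folds \<omega>))) (data \<omega> i)) \<le> c * H"
    if "\<omega> \<in> space M - ?E" "restrict (data \<omega>) (J (folds \<omega>)) \<in> G (folds \<omega>)" for \<omega>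
  proof -
    have "ennreal (T (\<Sum>i\<in>F (folds \<omega>). \<phi> (folds \<omega>) (restrict (data \<omega>) (J (folds \<omega>))) (data \<omega> i)))
        \<le> ennreal (c * H)"
      using that by (auto simp: h_def)
    then show ?thesis using assms(2,3) by (subst (asm) ennreal_le_iff) auto
  qed
  ultimately show ?thesis using assms(2,3) by (intro bexI[of _ ?E]) auto
qed

text \<open>The squared norm is a nonnegative integral here, so the set is measurable in the
  training data by Tonelli, and a finite bound already implies square integrability.\<close>

definition good_fit :: "real \<Rightarrow> nat set \<Rightarrow> (nat \<Rightarrow> real \<times> real \<times> (real ^ 'p)) set" where
  "good_fit \<delta> J = {d \<in> space (Pi\<^sub>M J (\<lambda>_. borel)).
     (\<integral>\<^sup>+u. ennreal ((L J d (X u) - \<mu> (X u))\<^sup>2) \<partial>P) \<le> ennreal (\<delta>\<^sup>2)}"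

lemma learner_measurable:
  assumes "J \<subseteq> {1..N}" "f \<in> A \<rightarrow>\<^sub>M Pi\<^sub>M J (\<lambda>_. borel)" "g \<in> borel_measurable A"
  shows "(\<lambda>a. L J (f a) (g a)) \<in> borel_measurable A"
proof -
  have "(\<lambda>(D, x). L J D x) \<in> borel_measurable (Pi\<^sub>M J (\<lambda>_. borel) \<Otimes>\<^sub>M borel)"
    using learner assms(1) by (simp add: measurable_learner_def)
  from measurable_compose[OF measurable_Pair[OF assms(2,3)] this] show ?thesis by simp
qed

lemma good_fit_sets:
  assumes "J \<subseteq> {1..N}"
  shows "good_fit \<delta> J \<in> sets (Pi\<^sub>M J (\<lambda>_. borel))"
proof -
  have [measurable]: "(\<lambda>(d, u). L J d (X u)) \<in> borel_measurable (Pi\<^sub>M J (\<lambda>_. borel) \<Otimes>\<^sub>M P)"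
    unfolding case_prod_beta' by (rule learner_measurable[OF assms]) measurable
  show ?thesis unfolding good_fit_def by measurable
qed

lemma good_fitD:
  assumes J: "J \<subseteq> {1..N}" and d: "d \<in> good_fit \<delta> J"
  shows "(\<lambda>x. L J d x - \<mu> x) \<in> borel_measurable borel"
    "integrable P (\<lambda>u. (L J d (X u) - \<mu> (X u))\<^sup>2)"
    "(LINT u|P. (L J d (X u) - \<mu> (X u))\<^sup>2) \<le> \<delta>\<^sup>2"
proof -
  have ds: "d \<in> space (Pi\<^sub>M J (\<lambda>_. borel))"
    and le: "(\<integral>\<^sup>+u. ennreal ((L J d (X u) - \<mu> (X u))\<^sup>2) \<partial>P) \<le> ennreal (\<delta>\<^sup>2)"
    using d by (auto simp: good_fit_def)
  have "(\<lambda>x. L J d x) \<in> borel_measurable borel"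
    by (rule learner_measurable[OF J]) (use ds in auto)
  then show [measurable]: "(\<lambda>x. L J d x - \<mu> x) \<in> borel_measurable borel" by measurable
  have [measurable]: "(\<lambda>u. (L J d (X u) - \<mu> (X u))\<^sup>2) \<in> borel_measurable P"
    using measurable_compose[OF Pop.X_measurable \<open>(\<lambda>x. L J d x - \<mu> x) \<in> borel_measurable borel\<close>] by simp
  show i: "integrable P (\<lambda>u. (L J d (X u) - \<mu> (X u))\<^sup>2)"
    using le by (intro integrableI_bounded) (auto intro: le_less_trans)
  show "(LINT u|P. (L J d (X u) - \<mu> (X u))\<^sup>2) \<le> \<delta>\<^sup>2"
    using le nn_integral_eq_integral[OF i] by simp
qed

text \<open>Since \<open>norm2\<close> is infinite outside L2, a real bound on it supplies
  integrability, and the two ways of writing the squared norm agree.\<close>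

lemma good_fitI:
  assumes d: "d \<in> space (Pi\<^sub>M J (\<lambda>_. borel))" and le: "norm2 P X (\<lambda>x. L J d x - \<mu> x) \<le> ereal \<delta>"
  shows "d \<in> good_fit \<delta> J"
proof -
  have i: "integrable P (\<lambda>u. (L J d (X u) - \<mu> (X u))\<^sup>2)"
    and l: "sqrt (LINT u|P. (L J d (X u) - \<mu> (X u))\<^sup>2) \<le> \<delta>"
    using le by (auto simp: norm2_def split: if_splits)
  then have "(LINT u|P. (L J d (X u) - \<mu> (X u))\<^sup>2) \<le> \<delta>\<^sup>2"
    using sqrt_le_D by blast
  then show ?thesis
    using d nn_integral_eq_integral[OF i] by (simp add: good_fit_def)
qed

lemma
  assumes "\<omega> \<in> space M" "k \<in> {1..K}"
  shows folds_fold: "folds \<omega> k = I \<omega> k"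
    and folds_train: "train_idx N (folds \<omega>) k = train_idx N (I \<omega>) k"
    and data_fold: "i \<in> I \<omega> k \<Longrightarrow> data \<omega> i = Z i \<omega>"
    and data_train: "i \<in> train_idx N (I \<omega>) k \<Longrightarrow> data \<omega> i = Z i \<omega>"
    and restrict_data: "restrict (data \<omega>) (train_idx N (I \<omega>) k) = restrict (\<lambda>i. Z i \<omega>) (train_idx N (I \<omega>) k)"
  using assms folds_cover[OF assms(1)]
  by (auto simp: folds_def train_idx_def data_def intro!: restrict_ext)

section \<open>Exceptional events for a single fold\<close>

definition "fold_size = N div K"

lemma fold_size: "N = K * fold_size" "0 < fold_size" "real N \<le> 2 * real (N - fold_size)" "fold_size < N"
proof -
  show N: "N = K * fold_size" using K_dvd_N by (simp add: fold_size_def)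
  then show "0 < fold_size" using N_pos by (cases fold_size) auto
  \<comment> \<open>With at least two folds of equal size, each training set holds at least half of
    the sample.\<close>
  have "2 * fold_size \<le> K * fold_size" using K_ge_2 by simp
  then have "2 * fold_size \<le> N" using N by simp
  then show "real N \<le> 2 * real (N - fold_size)" "fold_size < N" using \<open>0 < fold_size\<close> by auto
qed

lemma prob_label_sum:
  assumes k: "k \<in> {1..K}" and "0 < H"
  shows "\<exists>E\<in>events. prob E \<le> 1 / H \<and> (\<forall>\<omega>\<in>space M - E.
    (\<Sum>i\<in>train_idx N (I \<omega>) k. 1 - label (Z i \<omega>) / b)\<^sup>2 \<le> real (N - fold_size) * (1 / b) * H)"
proof -
  let ?J = "\<lambda>\<kappa>::nat \<Rightarrow> nat set. \<kappa> k" and ?F = "\<lambda>\<kappa>. train_idx N \<kappa> k"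
  let ?\<phi> = "\<lambda>\<kappa> d. ipw_error (\<lambda>_. 1)"
  have [measurable]: "ipw_error (\<lambda>_. 1) \<in> borel_measurable borel"
    unfolding ipw_error_def by measurable
  note mom = ipw_error_moments[of "\<lambda>_. 1", simplified, unfolded Pop.prob_space]
  have "\<exists>E\<in>events. prob E \<le> 1 / H \<and> (\<forall>\<omega>\<in>space M - E.
    restrict (data \<omega>) (?J (folds \<omega>)) \<in> space (Pi\<^sub>M (?J (folds \<omega>)) (\<lambda>_. borel)) \<longrightarrow>
    (\<Sum>i\<in>?F (folds \<omega>). ?\<phi> (folds \<omega>) (restrict (data \<omega>) (?J (folds \<omega>))) (data \<omega> i))\<^sup>2
      \<le> real (N - fold_size) * (1 / b) * H)"
  proof (rule prob_fold_sum_gt[where J = ?J and F = ?F and \<phi> = ?\<phi> and T = "\<lambda>t. t\<^sup>2"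
        and G = "\<lambda>\<kappa>. space (Pi\<^sub>M (\<kappa> k) (\<lambda>_. borel))"])
    fix \<kappa> assume "\<kappa> \<in> equal_folds N K"
    note F = equal_foldsD[OF this k]
    show "?J \<kappa> \<subseteq> {1..N}" "?F \<kappa> \<subseteq> {1..N}" by fact+
    show "(\<integral>\<^sup>+D. indicator (space (Pi\<^sub>M (\<kappa> k) (\<lambda>_. borel))) (restrict D (?J \<kappa>)) *
        ennreal ((\<Sum>i\<in>?F \<kappa>. ?\<phi> \<kappa> (restrict D (?J \<kappa>)) (D i))\<^sup>2) \<partial>Pi\<^sub>M {1..N} (\<lambda>_. obs_law))
      \<le> ennreal (real (N - fold_size) * (1 / b))"
      unfolding F(2)[symmetric] Un_commute[of _ "\<kappa> k"] F(6)[unfolded fold_size_def[symmetric], symmetric]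
      by (rule nn_integral_PiM_centered_sum_le[OF prob_space_obs_law[OF N_pos] F(1,4,5)])
         (use mom sets_obs_law[of "\<kappa> k"] in \<open>auto cong: measurable_cong_sets\<close>)
  qed (use fold_size b_pos \<open>0 < H\<close> in auto)
  then show ?thesis
    using k by (elim bexE conjE, intro bexI conjI)
      (auto simp: folds_train folds_fold data_train space_PiM ipw_error_def cong: sum.cong)
qed

text \<open>The summand is a fixed function, so again \<open>G\<close> is the whole space. Enlarging
  \<open>resid_var\<close> to a positive \<open>s\<close> provides the strictly positive level used
  in Markov's inequality.\<close>

lemma prob_resid_sum:
  assumes k: "k \<in> {1..K}" and "0 < H" and s: "resid_var \<le> s" "0 < s"
  shows "\<exists>E\<in>events. prob E \<le> 1 / H \<and> (\<forall>\<omega>\<in>space M - E.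
    (\<Sum>i\<in>I \<omega> k. resid (Z i \<omega>))\<^sup>2 \<le> real fold_size * (s / b) * H)"
proof -
  let ?F = "\<lambda>\<kappa>::nat \<Rightarrow> nat set. \<kappa> k" and ?J = "\<lambda>\<kappa>. train_idx N \<kappa> k"
  let ?\<phi> = "\<lambda>\<kappa> d. resid"
  have [measurable]: "resid \<in> borel_measurable borel"
    unfolding resid_def by measurable
  have var: "(LINT z|obs_law. (resid z)\<^sup>2) \<le> s / b"
    by (rule order_trans[OF resid_moments(4)]) (use s b_pos in \<open>simp add: divide_right_mono\<close>)
  have "\<exists>E\<in>events. prob E \<le> 1 / H \<and> (\<forall>\<omega>\<in>space M - E.
    restrict (data \<omega>) (?J (folds \<omega>)) \<in> space (Pi\<^sub>M (?J (folds \<omega>)) (\<lambda>_. borel)) \<longrightarrow>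
    (\<Sum>i\<in>?F (folds \<omega>). ?\<phi> (folds \<omega>) (restrict (data \<omega>) (?J (folds \<omega>))) (data \<omega> i))\<^sup>2
      \<le> real fold_size * (s / b) * H)"
  proof (rule prob_fold_sum_gt[where J = ?J and F = ?F and \<phi> = ?\<phi> and T = "\<lambda>t. t\<^sup>2"
        and G = "\<lambda>\<kappa>. space (Pi\<^sub>M (?J \<kappa>) (\<lambda>_. borel))"])
    fix \<kappa> assume "\<kappa> \<in> equal_folds N K"
    note F = equal_foldsD[OF this k]
    show "?J \<kappa> \<subseteq> {1..N}" "?F \<kappa> \<subseteq> {1..N}" by fact+
    show "(\<integral>\<^sup>+D. indicator (space (Pi\<^sub>M (?J \<kappa>) (\<lambda>_. borel))) (restrict D (?J \<kappa>)) *
        ennreal ((\<Sum>i\<in>?F \<kappa>. ?\<phi> \<kappa> (restrict D (?J \<kappa>)) (D i))\<^sup>2) \<partial>Pi\<^sub>M {1..N} (\<lambda>_. obs_law))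
      \<le> ennreal (real fold_size * (s / b))"
      unfolding F(2)[symmetric] F(3)[unfolded fold_size_def[symmetric], symmetric]
      by (rule nn_integral_PiM_centered_sum_le[OF prob_space_obs_law[OF N_pos] F(1)[unfolded Int_commute[of "\<kappa> k"]] F(5,4)])
         (use resid_moments(1-3) var sets_obs_law[of "?J \<kappa>"] in \<open>auto cong: measurable_cong_sets\<close>)
  qed (use fold_size b_pos \<open>0 < H\<close> s in auto)
  then show ?thesis
    using k by (elim bexE conjE, intro bexI conjI)
      (auto simp: folds_train folds_fold data_fold space_PiM cong: sum.cong)
qed

lemma fit_error_measurable:
  assumes J: "J \<subseteq> {1..N}"
  shows "(\<lambda>(d, z). ipw_error (\<lambda>x. L J d x - \<mu> x) z) \<in> borel_measurable (Pi\<^sub>M J (\<lambda>_. borel) \<Otimes>\<^sub>M borel)"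
    "(\<lambda>(d, z). \<bar>label z * (L J d (covariate z) - \<mu> (covariate z))\<bar>)
      \<in> borel_measurable (Pi\<^sub>M J (\<lambda>_. borel) \<Otimes>\<^sub>M borel)"
proof -
  have [measurable]: "(\<lambda>p. L J (fst p) (covariate (snd p))) \<in> borel_measurable (Pi\<^sub>M J (\<lambda>_. borel) \<Otimes>\<^sub>M borel)"
    by (rule learner_measurable[OF J]) measurable
  show "(\<lambda>(d, z). ipw_error (\<lambda>x. L J d x - \<mu> x) z) \<in> borel_measurable (Pi\<^sub>M J (\<lambda>_. borel) \<Otimes>\<^sub>M borel)"
    "(\<lambda>(d, z). \<bar>label z * (L J d (covariate z) - \<mu> (covariate z))\<bar>)
      \<in> borel_measurable (Pi\<^sub>M J (\<lambda>_. borel) \<Otimes>\<^sub>M borel)"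
    unfolding ipw_error_def case_prod_beta' by measurable
qed

lemma restrict_data_good_fit:
  assumes "\<omega> \<in> space M" "k \<in> {1..K}"
    and "norm2 P X (\<lambda>x. m_hat L N (I \<omega>) (\<lambda>i. Z i \<omega>) k x - \<mu> x) \<le> ereal \<delta>"
  shows "restrict (data \<omega>) (train_idx N (I \<omega>) k) \<in> good_fit \<delta> (train_idx N (I \<omega>) k)"
  using assms(3) by (intro good_fitI) (auto simp: space_PiM m_hat_def restrict_data[OF assms(1,2)])

text \<open>This is where cross-fitting pays off: once the training data are frozen, the fitted
  error is a fixed function of a fresh covariate, so the sum over the fold is centred although the
  learner is arbitrary.\<close>

lemma prob_fit_sum:
  assumes k: "k \<in> {1..K}" and "0 < H" "0 < \<delta>"
  shows "\<exists>E\<in>events. prob E \<le> 1 / H \<and> (\<forall>\<omega>\<in>space M - E.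
    norm2 P X (\<lambda>x. m_hat L N (I \<omega>) (\<lambda>i. Z i \<omega>) k x - \<mu> x) \<le> ereal \<delta> \<longrightarrow>
    (\<Sum>i\<in>I \<omega> k. ipw_error (\<lambda>x. m_hat L N (I \<omega>) (\<lambda>i. Z i \<omega>) k x - \<mu> x) (Z i \<omega>))\<^sup>2
      \<le> real fold_size * (\<delta>\<^sup>2 / b) * H)"
proof -
  let ?F = "\<lambda>\<kappa>::nat \<Rightarrow> nat set. \<kappa> k" and ?J = "\<lambda>\<kappa>. train_idx N \<kappa> k"
  let ?\<phi> = "\<lambda>\<kappa> d. ipw_error (\<lambda>x. L (?J \<kappa>) d x - \<mu> x)"
  have "\<exists>E\<in>events. prob E \<le> 1 / H \<and> (\<forall>\<omega>\<in>space M - E.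
    restrict (data \<omega>) (?J (folds \<omega>)) \<in> good_fit \<delta> (?J (folds \<omega>)) \<longrightarrow>
    (\<Sum>i\<in>?F (folds \<omega>). ?\<phi> (folds \<omega>) (restrict (data \<omega>) (?J (folds \<omega>))) (data \<omega> i))\<^sup>2
      \<le> real fold_size * (\<delta>\<^sup>2 / b) * H)"
  proof (rule prob_fold_sum_gt[where J = ?J and F = ?F and \<phi> = ?\<phi> and T = "\<lambda>t. t\<^sup>2"
        and G = "\<lambda>\<kappa>. good_fit \<delta> (?J \<kappa>)"])
    fix \<kappa> assume "\<kappa> \<in> equal_folds N K"
    note F = equal_foldsD[OF this k]
    show "?J \<kappa> \<subseteq> {1..N}" "?F \<kappa> \<subseteq> {1..N}" by fact+
    show meas: "(\<lambda>(d, z). ?\<phi> \<kappa> d z) \<in> borel_measurable (Pi\<^sub>M (?J \<kappa>) (\<lambda>_. borel) \<Otimes>\<^sub>M borel)"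
      by (rule fit_error_measurable) fact
    show G: "good_fit \<delta> (?J \<kappa>) \<in> sets (Pi\<^sub>M (?J \<kappa>) (\<lambda>_. borel))"
      by (rule good_fit_sets) fact
    have pair: "sets (Pi\<^sub>M (?J \<kappa>) (\<lambda>_. obs_law) \<Otimes>\<^sub>M obs_law) = sets (Pi\<^sub>M (?J \<kappa>) (\<lambda>_. borel) \<Otimes>\<^sub>M borel)"
      by (intro sets_pair_measure_cong sets_obs_law) simp
    show "(\<integral>\<^sup>+D. indicator (good_fit \<delta> (?J \<kappa>)) (restrict D (?J \<kappa>)) *
        ennreal ((\<Sum>i\<in>?F \<kappa>. ?\<phi> \<kappa> (restrict D (?J \<kappa>)) (D i))\<^sup>2) \<partial>Pi\<^sub>M {1..N} (\<lambda>_. obs_law))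
      \<le> ennreal (real fold_size * (\<delta>\<^sup>2 / b))"
      unfolding F(2)[symmetric] F(3)[unfolded fold_size_def[symmetric], symmetric]
    proof (rule nn_integral_PiM_centered_sum_le[OF prob_space_obs_law[OF N_pos]
          F(1)[unfolded Int_commute[of "\<kappa> k"]] F(5,4)])
      fix d assume "d \<in> good_fit \<delta> (?J \<kappa>)"
      note d = good_fitD[OF F(7) this]
      note mom = ipw_error_moments[OF d(1,2)]
      show "integrable obs_law (?\<phi> \<kappa> d)" "integrable obs_law (\<lambda>z. (?\<phi> \<kappa> d z)\<^sup>2)"
        "(LINT z|obs_law. ?\<phi> \<kappa> d z) = 0" by (fact mom)+
      show "(LINT z|obs_law. (?\<phi> \<kappa> d z)\<^sup>2) \<le> \<delta>\<^sup>2 / b"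
        by (rule order_trans[OF mom(4)]) (use d(3) b_pos in \<open>simp add: divide_right_mono\<close>)
    qed (use G meas in \<open>simp_all add: sets_obs_law cong: measurable_cong_sets[OF pair]\<close>)
  qed (use fold_size b_pos assms in auto)
  then obtain E where E: "E \<in> events" "prob E \<le> 1 / H"
    and le: "\<And>\<omega>. \<omega> \<in> space M - E \<Longrightarrow>
      restrict (data \<omega>) (?J (folds \<omega>)) \<in> good_fit \<delta> (?J (folds \<omega>)) \<Longrightarrow>
      (\<Sum>i\<in>?F (folds \<omega>). ?\<phi> (folds \<omega>) (restrict (data \<omega>) (?J (folds \<omega>))) (data \<omega> i))\<^sup>2
        \<le> real fold_size * (\<delta>\<^sup>2 / b) * H" by blast
  show ?thesis
  proof (intro bexI[OF _ E(1)] conjI[OF E(2)] ballI impI)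
    fix \<omega> assume w: "\<omega> \<in> space M - E"
      and n: "norm2 P X (\<lambda>x. m_hat L N (I \<omega>) (\<lambda>i. Z i \<omega>) k x - \<mu> x) \<le> ereal \<delta>"
    then have ws: "\<omega> \<in> space M" by simp
    show "(\<Sum>i\<in>I \<omega> k. ipw_error (\<lambda>x. m_hat L N (I \<omega>) (\<lambda>i. Z i \<omega>) k x - \<mu> x) (Z i \<omega>))\<^sup>2
      \<le> real fold_size * (\<delta>\<^sup>2 / b) * H"
      using le[OF w, unfolded folds_train[OF ws k] folds_fold[OF ws k], OF restrict_data_good_fit[OF ws k n]]
      by (simp add: restrict_data[OF ws k] m_hat_def data_fold[OF ws k] cong: sum.cong)
  qed
qed

text \<open>The labelled errors need not be centred, so only their size is controlled. That suffices
  because the sum is multiplied by \<rho>_k, which is itself of the target order.\<close>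

lemma prob_labelled_fit_sum:
  assumes k: "k \<in> {1..K}" and "0 < H" "0 < \<delta>"
  shows "\<exists>E\<in>events. prob E \<le> 1 / H \<and> (\<forall>\<omega>\<in>space M - E.
    norm2 P X (\<lambda>x. m_hat L N (I \<omega>) (\<lambda>i. Z i \<omega>) k x - \<mu> x) \<le> ereal \<delta> \<longrightarrow>
    (\<Sum>i\<in>I \<omega> k. \<bar>label (Z i \<omega>) * (m_hat L N (I \<omega>) (\<lambda>i. Z i \<omega>) k (covariate (Z i \<omega>))
        - \<mu> (covariate (Z i \<omega>)))\<bar>)
      \<le> real fold_size * (b * \<delta>) * H)"
proof -
  let ?F = "\<lambda>\<kappa>::nat \<Rightarrow> nat set. \<kappa> k" and ?J = "\<lambda>\<kappa>. train_idx N \<kappa> k"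
  let ?\<phi> = "\<lambda>\<kappa> d z. \<bar>label z * (L (?J \<kappa>) d (covariate z) - \<mu> (covariate z))\<bar>"
  have "\<exists>E\<in>events. prob E \<le> 1 / H \<and> (\<forall>\<omega>\<in>space M - E.
    restrict (data \<omega>) (?J (folds \<omega>)) \<in> good_fit \<delta> (?J (folds \<omega>)) \<longrightarrow>
    (\<Sum>i\<in>?F (folds \<omega>). ?\<phi> (folds \<omega>) (restrict (data \<omega>) (?J (folds \<omega>))) (data \<omega> i))
      \<le> real fold_size * (b * \<delta>) * H)"
  proof (rule prob_fold_sum_gt[where J = ?J and F = ?F and \<phi> = ?\<phi> and T = "\<lambda>t. t"
        and G = "\<lambda>\<kappa>. good_fit \<delta> (?J \<kappa>)"])
    fix \<kappa> assume "\<kappa> \<in> equal_folds N K"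
    note F = equal_foldsD[OF this k]
    show "?J \<kappa> \<subseteq> {1..N}" "?F \<kappa> \<subseteq> {1..N}" by fact+
    show meas: "(\<lambda>(d, z). ?\<phi> \<kappa> d z) \<in> borel_measurable (Pi\<^sub>M (?J \<kappa>) (\<lambda>_. borel) \<Otimes>\<^sub>M borel)"
      by (rule fit_error_measurable) fact
    show G: "good_fit \<delta> (?J \<kappa>) \<in> sets (Pi\<^sub>M (?J \<kappa>) (\<lambda>_. borel))"
      by (rule good_fit_sets) fact
    have pair: "sets (Pi\<^sub>M (?J \<kappa>) (\<lambda>_. obs_law) \<Otimes>\<^sub>M obs_law) = sets (Pi\<^sub>M (?J \<kappa>) (\<lambda>_. borel) \<Otimes>\<^sub>M borel)"
      by (intro sets_pair_measure_cong sets_obs_law) simp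
    show "(\<integral>\<^sup>+D. indicator (good_fit \<delta> (?J \<kappa>)) (restrict D (?J \<kappa>)) *
        ennreal (\<Sum>i\<in>?F \<kappa>. ?\<phi> \<kappa> (restrict D (?J \<kappa>)) (D i)) \<partial>Pi\<^sub>M {1..N} (\<lambda>_. obs_law))
      \<le> ennreal (real fold_size * (b * \<delta>))"
      unfolding F(2)[symmetric] F(3)[unfolded fold_size_def[symmetric], symmetric]
    proof (rule nn_integral_PiM_nonneg_sum_le[OF prob_space_obs_law[OF N_pos]
          F(1)[unfolded Int_commute[of "\<kappa> k"]] F(5,4)])
      fix d assume "d \<in> good_fit \<delta> (?J \<kappa>)"
      note d = good_fitD[OF F(7) this]
      show "(\<integral>\<^sup>+z. ennreal (?\<phi> \<kappa> d z) \<partial>obs_law) \<le> ennreal (b * \<delta>)"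
        by (rule labelled_abs_moment[OF d \<open>0 < \<delta>\<close>])
    qed (use G meas in \<open>simp_all add: sets_obs_law cong: measurable_cong_sets[OF pair]\<close>)
  qed (use fold_size b_pos assms in auto)
  then obtain E where E: "E \<in> events" "prob E \<le> 1 / H"
    and le: "\<And>\<omega>. \<omega> \<in> space M - E \<Longrightarrow>
      restrict (data \<omega>) (?J (folds \<omega>)) \<in> good_fit \<delta> (?J (folds \<omega>)) \<Longrightarrow>
      (\<Sum>i\<in>?F (folds \<omega>). ?\<phi> (folds \<omega>) (restrict (data \<omega>) (?J (folds \<omega>))) (data \<omega> i))
        \<le> real fold_size * (b * \<delta>) * H" by blast
  show ?thesis
  proof (intro bexI[OF _ E(1)] conjI[OF E(2)] ballI impI)
    fix \<omega> assume w: "\<omega> \<in> space M - E"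
      and n: "norm2 P X (\<lambda>x. m_hat L N (I \<omega>) (\<lambda>i. Z i \<omega>) k x - \<mu> x) \<le> ereal \<delta>"
    then have ws: "\<omega> \<in> space M" by simp
    show "(\<Sum>i\<in>I \<omega> k. \<bar>label (Z i \<omega>) * (m_hat L N (I \<omega>) (\<lambda>i. Z i \<omega>) k (covariate (Z i \<omega>))
        - \<mu> (covariate (Z i \<omega>)))\<bar>) \<le> real fold_size * (b * \<delta>) * H"
      using le[OF w, unfolded folds_train[OF ws k] folds_fold[OF ws k], OF restrict_data_good_fit[OF ws k n]]
      by (simp add: restrict_data[OF ws k] m_hat_def data_fold[OF ws k] cong: sum.cong)
  qed
qed

lemma prob_propensity_error:
  assumes k: "k \<in> {1..K}" and "0 < H"
  shows "\<exists>E\<in>events. prob E \<le> 1 / H \<and> (\<forall>\<omega>\<in>space M - E. \<forall>x :: real ^ 'p.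
    (pi_hat N (I \<omega>) (\<lambda>i. label (Z i \<omega>)) k x / b - 1)\<^sup>2 \<le> 2 * H / (real N * b))"
proof -
  obtain E where E: "E \<in> events" "prob E \<le> 1 / H" and le: "\<And>\<omega>. \<omega> \<in> space M - E \<Longrightarrow>
    (\<Sum>i\<in>train_idx N (I \<omega>) k. 1 - label (Z i \<omega>) / b)\<^sup>2 \<le> real (N - fold_size) * (1 / b) * H"
    using prob_label_sum[OF assms] by blast
  have "(pi_hat N (I \<omega>) (\<lambda>i. label (Z i \<omega>)) k x / b - 1)\<^sup>2 \<le> 2 * H / (real N * b)"
    if w: "\<omega> \<in> space M - E" for \<omega> and x :: "real ^ 'p"
  proof -
    define n where "n = real (N - fold_size)"
    have n: "0 < n" "real N \<le> 2 * n" using fold_size by (auto simp: n_def)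
    have c: "real (card (train_idx N (I \<omega>) k)) = n"
      using equal_foldsD(6)[OF folds_in k, of \<omega>] w folds_train[of \<omega> k] k by (simp add: n_def fold_size_def)
    have "pi_hat N (I \<omega>) (\<lambda>i. label (Z i \<omega>)) k x / b - 1
      = - (\<Sum>i\<in>train_idx N (I \<omega>) k. 1 - label (Z i \<omega>) / b) / n"
      using n b_pos unfolding pi_hat_def sum_subtractf sum_divide_distrib[symmetric]
      by (simp add: c field_simps)
    then have "(pi_hat N (I \<omega>) (\<lambda>i. label (Z i \<omega>)) k x / b - 1)\<^sup>2
      = (\<Sum>i\<in>train_idx N (I \<omega>) k. 1 - label (Z i \<omega>) / b)\<^sup>2 / n\<^sup>2"
      by (simp add: power_divide)
    also have "\<dots> \<le> (n * (1 / b) * H) / n\<^sup>2"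
      using le[OF w] by (intro divide_right_mono) (auto simp: n_def)
    also have "\<dots> = H / (n * b)" using n by (simp add: power2_eq_square)
    \<comment> \<open>Replacing the size of the training set by \<open>N / 2\<close> is the source
      of the factor 2 in the bound.\<close>
    also have "\<dots> \<le> H / (real N / 2 * b)"
      using n b_pos N_pos \<open>0 < H\<close> by (intro divide_left_mono mult_right_mono) auto
    finally show ?thesis by (simp add: mult.commute)
  qed
  then show ?thesis by (intro bexI[OF _ E(1)] conjI[OF E(2)] ballI allI)
qed

text \<open>A union of four exceptional events, one for each bound. Only the two bounds on the
  fitting error are conditional on the quality of the fit.\<close>

lemma prob_fold_events:
  assumes k: "k \<in> {1..K}" and "0 < H" "0 < \<delta>" and s: "resid_var \<le> s" "0 < s"
  shows "\<exists>E\<in>events. prob E \<le> 4 / H \<and> (\<forall>\<omega>\<in>space M - E.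
    (\<forall>x :: real ^ 'p. (pi_hat N (I \<omega>) (\<lambda>i. label (Z i \<omega>)) k x / b - 1)\<^sup>2 \<le> 2 * H / (real N * b)) \<and>
    (\<Sum>i\<in>I \<omega> k. resid (Z i \<omega>))\<^sup>2 \<le> real fold_size * (s / b) * H \<and>
    (norm2 P X (\<lambda>x. m_hat L N (I \<omega>) (\<lambda>i. Z i \<omega>) k x - \<mu> x) \<le> ereal \<delta> \<longrightarrow>
      (\<Sum>i\<in>I \<omega> k. ipw_error (\<lambda>x. m_hat L N (I \<omega>) (\<lambda>i. Z i \<omega>) k x - \<mu> x) (Z i \<omega>))\<^sup>2
        \<le> real fold_size * (\<delta>\<^sup>2 / b) * H \<and>
      (\<Sum>i\<in>I \<omega> k. \<bar>label (Z i \<omega>) * (m_hat L N (I \<omega>) (\<lambda>i. Z i \<omega>) k (covariate (Z i \<omega>))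
        - \<mu> (covariate (Z i \<omega>)))\<bar>) \<le> real fold_size * (b * \<delta>) * H))"
proof -
  note ex = prob_propensity_error[OF k \<open>0 < H\<close>] prob_resid_sum[OF k \<open>0 < H\<close> s]
    prob_fit_sum[OF k \<open>0 < H\<close> \<open>0 < \<delta>\<close>] prob_labelled_fit_sum[OF k \<open>0 < H\<close> \<open>0 < \<delta>\<close>]
  from ex(1) obtain E1 where 1: "E1 \<in> events" "prob E1 \<le> 1 / H" and e1: "\<forall>\<omega>\<in>space M - E1. \<forall>x :: real ^ 'p.
    (pi_hat N (I \<omega>) (\<lambda>i. label (Z i \<omega>)) k x / b - 1)\<^sup>2 \<le> 2 * H / (real N * b)" by (elim bexE conjE)
  from ex(2) obtain E2 where 2: "E2 \<in> events" "prob E2 \<le> 1 / H" and e2: "\<forall>\<omega>\<in>space M - E2.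
    (\<Sum>i\<in>I \<omega> k. resid (Z i \<omega>))\<^sup>2 \<le> real fold_size * (s / b) * H" by (elim bexE conjE)
  from ex(3) obtain E3 where 3: "E3 \<in> events" "prob E3 \<le> 1 / H" and e3: "\<forall>\<omega>\<in>space M - E3.
    norm2 P X (\<lambda>x. m_hat L N (I \<omega>) (\<lambda>i. Z i \<omega>) k x - \<mu> x) \<le> ereal \<delta> \<longrightarrow>
    (\<Sum>i\<in>I \<omega> k. ipw_error (\<lambda>x. m_hat L N (I \<omega>) (\<lambda>i. Z i \<omega>) k x - \<mu> x) (Z i \<omega>))\<^sup>2
      \<le> real fold_size * (\<delta>\<^sup>2 / b) * H" by (elim bexE conjE)
  from ex(4) obtain E4 where 4: "E4 \<in> events" "prob E4 \<le> 1 / H" and e4: "\<forall>\<omega>\<in>space M - E4.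
    norm2 P X (\<lambda>x. m_hat L N (I \<omega>) (\<lambda>i. Z i \<omega>) k x - \<mu> x) \<le> ereal \<delta> \<longrightarrow>
    (\<Sum>i\<in>I \<omega> k. \<bar>label (Z i \<omega>) * (m_hat L N (I \<omega>) (\<lambda>i. Z i \<omega>) k (covariate (Z i \<omega>))
        - \<mu> (covariate (Z i \<omega>)))\<bar>) \<le> real fold_size * (b * \<delta>) * H" by (elim bexE conjE)
  let ?E = "(E1 \<union> E2) \<union> (E3 \<union> E4)"
  have "prob ?E \<le> (prob E1 + prob E2) + (prob E3 + prob E4)"
    using 1(1) 2(1) 3(1) 4(1)
    by (intro order_trans[OF measure_Un_le] add_mono measure_Un_le) auto
  also have "\<dots> \<le> 4 / H" using 1(2) 2(2) 3(2) 4(2) by simp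
  finally have "prob ?E \<le> 4 / H" .
  moreover have "?E \<in> events" using 1(1) 2(1) 3(1) 4(1) by auto
  ultimately show ?thesis
    by (intro bexI[of _ ?E] conjI ballI impI allI)
       (assumption, rule e1[THEN bspec, THEN spec], simp, rule e2[THEN bspec], simp,
        rule e3[THEN bspec, THEN mp], simp, assumption, rule e4[THEN bspec, THEN mp], simp, assumption, assumption)
qed

section \<open>Measurability of the estimated propensity and of the remainder\<close>

lemma pi_hat_measurable:
  "(\<lambda>\<omega>. pi_hat N (I \<omega>) (\<lambda>i. label (Z i \<omega>)) k x) \<in> borel_measurable M" if k: "k \<in> {1..K}"
proof -
  have "(\<lambda>\<omega>. pi_hat N (folds \<omega>) (\<lambda>i. label (data \<omega> i)) k x) \<in> borel_measurable M"
  proof (rule measurable_folds_data[where G = "\<lambda>\<kappa> D. pi_hat N \<kappa> (\<lambda>i. label (D i)) k x"])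
    fix \<kappa> assume "\<kappa> \<in> equal_folds N K"
    note F = equal_foldsD[OF this k]
    have "(\<lambda>D :: nat \<Rightarrow> real \<times> real \<times> (real ^ 'p). label (D i)) \<in> borel_measurable (Pi\<^sub>M {1..N} (\<lambda>_. borel))" if "i \<in> train_idx N \<kappa> k" for i
    proof -
      have "i \<in> {1..N}" using that F(7) by blast
      from measurable_compose[OF measurable_component_singleton[OF this, of "\<lambda>_. borel"] obs_measurable(1)]
      show ?thesis .
    qed
    then show "(\<lambda>D :: nat \<Rightarrow> real \<times> real \<times> (real ^ 'p). pi_hat N \<kappa> (\<lambda>i. label (D i)) k x) \<in> borel_measurable (Pi\<^sub>M {1..N} (\<lambda>_. borel))"
      unfolding pi_hat_def by (intro borel_measurable_divide borel_measurable_sum) auto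
  qed
  then show ?thesis
    by (rule measurable_cong[THEN iffD1, rotated])
       (simp add: pi_hat_def folds_train[OF _ k] data_train[OF _ k] cong: sum.cong)
qed

text \<open>Measurability is given for the observations only, not for the separate outcomes
  \<open>Ys i\<close>. So the remainder is rewritten as a function of the partition and the data
  alone, and the finitely many partitions are treated one at a time.\<close>

lemma DRSS_remainder_measurable:
  assumes Z: "\<And>i \<omega>. Z i \<omega> = observe (Rs i \<omega>) (Ys i \<omega>) (Xs i \<omega>)"
  shows "(\<lambda>\<omega>. theta_DRSS K N (I \<omega>) (m_hat L N (I \<omega>) (\<lambda>i. Z i \<omega>)) (pi_hat N (I \<omega>) (\<lambda>i. Rs i \<omega>))
        (\<lambda>i. Rs i \<omega>) (\<lambda>i. Ys i \<omega>) (\<lambda>i. Xs i \<omega>) - \<theta>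
      - (1 / real N) * (\<Sum>i=1..N. psi_mu \<mu> b \<theta> (Rs i \<omega>) (Ys i \<omega>) (Xs i \<omega>) + IF_pi b \<Delta> (Rs i \<omega>)))
    \<in> borel_measurable M"
proof -
  \<comment> \<open>The identity \<open>r / p * (y - m) = (r * y - r * m) / p\<close> brings in the
    observed product. It holds at \<open>p = 0\<close> as well, where both sides are 0 by
    convention, so training sets without labels do no harm. The estimated propensity is constant in
    its covariate, hence the dummy argument \<open>0::nat\<close>.\<close>
  define G where "G \<kappa> D = (1 / real N) * (\<Sum>k=1..K. \<Sum>i\<in>\<kappa> k.
      m_hat L N \<kappa> D k (covariate (D i)) + (labelled_outcome (D i) - label (D i) * m_hat L N \<kappa> D k (covariate (D i)))
        / pi_hat N \<kappa> (\<lambda>i. label (D i)) k (0::nat)) - \<theta>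
    - (1 / real N) * (\<Sum>i=1..N. (labelled_outcome (D i) - label (D i) * \<mu> (covariate (D i))) / b
        + \<mu> (covariate (D i)) - \<theta> + (label (D i) - b) / b * \<Delta>)"
    for \<kappa> :: "nat \<Rightarrow> nat set" and D :: "nat \<Rightarrow> real \<times> real \<times> (real ^ 'p)"
  have "(\<lambda>\<omega>. G (folds \<omega>) (data \<omega>)) \<in> borel_measurable M"
  proof (rule measurable_folds_data)
    fix \<kappa> assume \<kappa>: "\<kappa> \<in> equal_folds N K"
    have comp: "(\<lambda>D. g (D i)) \<in> Pi\<^sub>M {1..N} (\<lambda>_. borel) \<rightarrow>\<^sub>M A"
      if "i \<in> {1..N}" "g \<in> borel \<rightarrow>\<^sub>M A" for i and g :: "real \<times> real \<times> (real ^ 'p) \<Rightarrow> 'z" and A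
      using measurable_compose[OF measurable_component_singleton[OF that(1), of "\<lambda>_. borel"] that(2)] .
    note lab = comp[OF _ obs_measurable(1)] and out = comp[OF _ obs_measurable(2)]
      and cov = comp[OF _ obs_measurable(3)]
    have mu: "(\<lambda>D. \<mu> (covariate (D i))) \<in> borel_measurable (Pi\<^sub>M {1..N} (\<lambda>_. borel))" if "i \<in> {1..N}" for i
      by (rule measurable_compose[OF cov[OF that] mu_measurable])
    have fold: "(\<lambda>D. m_hat L N \<kappa> D k (covariate (D i))) \<in> borel_measurable (Pi\<^sub>M {1..N} (\<lambda>_. borel))"
      if "k \<in> {1..K}" "i \<in> {1..N}" for k i
      unfolding m_hat_def using equal_foldsD(7)[OF \<kappa> that(1)] that(2)
      by (intro learner_measurable measurable_restrict_subset cov) auto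
    have ph: "(\<lambda>D :: nat \<Rightarrow> real \<times> real \<times> (real ^ 'p). pi_hat N \<kappa> (\<lambda>i. label (D i)) k (0::nat)) \<in> borel_measurable (Pi\<^sub>M {1..N} (\<lambda>_. borel))"
      if "k \<in> {1..K}" for k
      unfolding pi_hat_def using equal_foldsD(7)[OF \<kappa> that]
      by (intro borel_measurable_divide borel_measurable_sum lab) auto
    have sub: "i \<in> {1..N}" if "k \<in> {1..K}" "i \<in> \<kappa> k" for k i
      using equal_foldsD(8)[OF \<kappa> that(1)] that(2) by blast
    have "(\<lambda>D. m_hat L N \<kappa> D k (covariate (D i)) + (labelled_outcome (D i) - label (D i) * m_hat L N \<kappa> D k (covariate (D i)))
        / pi_hat N \<kappa> (\<lambda>i. label (D i)) k (0::nat)) \<in> borel_measurable (Pi\<^sub>M {1..N} (\<lambda>_. borel))"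
      if k: "k \<in> {1..K}" and i: "i \<in> {1..N}" for k i
      by (intro borel_measurable_add borel_measurable_divide borel_measurable_diff borel_measurable_times
          fold[OF k i] ph[OF k] lab[OF i] out[OF i])
    note 1 = this[OF _ sub]
    have 2: "(\<lambda>D. (labelled_outcome (D i) - label (D i) * \<mu> (covariate (D i))) / b
        + \<mu> (covariate (D i)) - \<theta> + (label (D i) - b) / b * \<Delta>) \<in> borel_measurable (Pi\<^sub>M {1..N} (\<lambda>_. borel))"
      if i: "i \<in> {1..N}" for i
      by (intro borel_measurable_add borel_measurable_divide borel_measurable_diff borel_measurable_times
          borel_measurable_const lab[OF i] out[OF i] mu[OF i])
    show "G \<kappa> \<in> borel_measurable (Pi\<^sub>M {1..N} (\<lambda>_. borel))"
      unfolding G_def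
      by (intro borel_measurable_diff borel_measurable_times borel_measurable_sum borel_measurable_const 1 2)
  qed
  moreover have "G (folds \<omega>) (data \<omega>)
    = theta_DRSS K N (I \<omega>) (m_hat L N (I \<omega>) (\<lambda>i. Z i \<omega>)) (pi_hat N (I \<omega>) (\<lambda>i. Rs i \<omega>))
        (\<lambda>i. Rs i \<omega>) (\<lambda>i. Ys i \<omega>) (\<lambda>i. Xs i \<omega>) - \<theta>
      - (1 / real N) * (\<Sum>i=1..N. psi_mu \<mu> b \<theta> (Rs i \<omega>) (Ys i \<omega>) (Xs i \<omega>) + IF_pi b \<Delta> (Rs i \<omega>))"
    if w: "\<omega> \<in> space M" for \<omega>
  proof -
    note J = folds_disjoint[OF w] folds_cover[OF w]
    have D: "data \<omega> i = observe (Rs i \<omega>) (Ys i \<omega>) (Xs i \<omega>)" if "i \<in> {1..N}" for i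
      using that by (simp add: data_def Z)
    have mhat: "m_hat L N (folds \<omega>) (data \<omega>) k = m_hat L N (I \<omega>) (\<lambda>i. Z i \<omega>) k" if "k \<in> {1..K}" for k
      unfolding m_hat_def folds_train[OF w that] restrict_data[OF w that] ..
    have phat: "pi_hat N (folds \<omega>) (\<lambda>i. label (data \<omega> i)) k (0::nat) = pi_hat N (I \<omega>) (\<lambda>i. Rs i \<omega>) k x"
      if "k \<in> {1..K}" for k and x :: "real ^ 'p"
      using data_train[OF w that] by (simp add: pi_hat_def folds_train[OF w that] Z cong: sum.cong)
    have 1: "(\<Sum>k=1..K. \<Sum>i\<in>folds \<omega> k.
        m_hat L N (folds \<omega>) (data \<omega>) k (covariate (data \<omega> i))
        + (labelled_outcome (data \<omega> i) - label (data \<omega> i) * m_hat L N (folds \<omega>) (data \<omega>) k (covariate (data \<omega> i)))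
          / pi_hat N (folds \<omega>) (\<lambda>i. label (data \<omega> i)) k (0::nat))
      = (\<Sum>i=1..N. let k = fold_of K (I \<omega>) i in m_hat L N (I \<omega>) (\<lambda>i. Z i \<omega>) k (Xs i \<omega>)
        + Rs i \<omega> / pi_hat N (I \<omega>) (\<lambda>i. Rs i \<omega>) k (Xs i \<omega>) * (Ys i \<omega> - m_hat L N (I \<omega>) (\<lambda>i. Z i \<omega>) k (Xs i \<omega>)))"
      unfolding sum_equal_folds[OF J]
    proof (intro sum.cong)
      fix k i assume k: "k \<in> {1..K}" and "i \<in> I \<omega> k"
      then have i: "i \<in> {1..N}" using J(2) by blast
      show "m_hat L N (folds \<omega>) (data \<omega>) k (covariate (data \<omega> i))
        + (labelled_outcome (data \<omega> i) - label (data \<omega> i) * m_hat L N (folds \<omega>) (data \<omega>) k (covariate (data \<omega> i)))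
          / pi_hat N (folds \<omega>) (\<lambda>i. label (data \<omega> i)) k (0::nat)
      = (let k = fold_of K (I \<omega>) i in m_hat L N (I \<omega>) (\<lambda>i. Z i \<omega>) k (Xs i \<omega>)
        + Rs i \<omega> / pi_hat N (I \<omega>) (\<lambda>i. Rs i \<omega>) k (Xs i \<omega>) * (Ys i \<omega> - m_hat L N (I \<omega>) (\<lambda>i. Z i \<omega>) k (Xs i \<omega>)))"
        unfolding Let_def fold_of_eq[OF J(1) k \<open>i \<in> I \<omega> k\<close>] mhat[OF k] phat[OF k, of "Xs i \<omega>"] D[OF i] observe_simps
        by (simp add: diff_divide_distrib right_diff_distrib)
    qed (auto simp: folds_fold[OF w])
    have 2: "(\<Sum>i=1..N. (labelled_outcome (data \<omega> i) - label (data \<omega> i) * \<mu> (covariate (data \<omega> i))) / b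
        + \<mu> (covariate (data \<omega> i)) - \<theta> + (label (data \<omega> i) - b) / b * \<Delta>)
      = (\<Sum>i=1..N. psi_mu \<mu> b \<theta> (Rs i \<omega>) (Ys i \<omega>) (Xs i \<omega>) + IF_pi b \<Delta> (Rs i \<omega>))"
      by (intro sum.cong refl) (simp add: D psi_mu_def IF_pi_def diff_divide_distrib right_diff_distrib)
    show ?thesis
      unfolding G_def 1 2 theta_DRSS_def ..
  qed
  ultimately show ?thesis
    by (rule measurable_cong[THEN iffD1, rotated])
qed

text \<open>The exceptional event is the union over the folds. The premise on \<open>norm2\<close>
  stays inside the implication, so this bound holds for every \<delta> and leaves the convergence of
  the learner to the limit argument.\<close>

lemma prob_DRSS_remainder:
  assumes Z: "\<And>i \<omega>. Z i \<omega> = observe (Rs i \<omega>) (Ys i \<omega>) (Xs i \<omega>)"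
    and "0 < H" "0 < \<delta>" and s: "resid_var \<le> s" "0 < s" and small: "2 * H / (real N * b) \<le> 1/4"
    and W: "W = sqrt (H / (real N * b))"
  shows "\<exists>E\<in>events. prob E \<le> real K * (4 / H) \<and> (\<forall>\<omega>\<in>space M - E.
    (\<forall>k\<in>{1..K}. norm2 P X (\<lambda>x. m_hat L N (I \<omega>) (\<lambda>i. Z i \<omega>) k x - \<mu> x) \<le> ereal \<delta>) \<longrightarrow>
    \<bar>theta_DRSS K N (I \<omega>) (m_hat L N (I \<omega>) (\<lambda>i. Z i \<omega>)) (pi_hat N (I \<omega>) (\<lambda>i. Rs i \<omega>))
        (\<lambda>i. Rs i \<omega>) (\<lambda>i. Ys i \<omega>) (\<lambda>i. Xs i \<omega>) - \<theta>
      - (1 / real N) * (\<Sum>i=1..N. psi_mu \<mu> b \<theta> (Rs i \<omega>) (Ys i \<omega>) (Xs i \<omega>) + IF_pi b \<Delta> (Rs i \<omega>))\<bar>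
    \<le> real K * (W * (\<delta> * (1 + 4 * H) + 4 * W * (sqrt s + \<bar>\<Delta>\<bar>))))"
proof -
  have "\<exists>E. \<forall>k\<in>{1..K}. E k \<in> events \<and> prob (E k) \<le> 4 / H \<and> (\<forall>\<omega>\<in>space M - E k.
    (\<forall>x :: real ^ 'p. (pi_hat N (I \<omega>) (\<lambda>i. label (Z i \<omega>)) k x / b - 1)\<^sup>2 \<le> 2 * H / (real N * b)) \<and>
    (\<Sum>i\<in>I \<omega> k. resid (Z i \<omega>))\<^sup>2 \<le> real fold_size * (s / b) * H \<and>
    (norm2 P X (\<lambda>x. m_hat L N (I \<omega>) (\<lambda>i. Z i \<omega>) k x - \<mu> x) \<le> ereal \<delta> \<longrightarrow>
      (\<Sum>i\<in>I \<omega> k. ipw_error (\<lambda>x. m_hat L N (I \<omega>) (\<lambda>i. Z i \<omega>) k x - \<mu> x) (Z i \<omega>))\<^sup>2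
        \<le> real fold_size * (\<delta>\<^sup>2 / b) * H \<and>
      (\<Sum>i\<in>I \<omega> k. \<bar>label (Z i \<omega>) * (m_hat L N (I \<omega>) (\<lambda>i. Z i \<omega>) k (covariate (Z i \<omega>))
        - \<mu> (covariate (Z i \<omega>)))\<bar>) \<le> real fold_size * (b * \<delta>) * H))"
    using prob_fold_events[OF _ \<open>0 < H\<close> \<open>0 < \<delta>\<close> s]
    by (intro bchoice ballI) (simp only: Bex_def conj_assoc)
  then obtain E where E: "\<And>k. k \<in> {1..K} \<Longrightarrow> E k \<in> events" "\<And>k. k \<in> {1..K} \<Longrightarrow> prob (E k) \<le> 4 / H"
    and q: "\<And>k \<omega> x. k \<in> {1..K} \<Longrightarrow> \<omega> \<in> space M - E k \<Longrightarrow>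
      (pi_hat N (I \<omega>) (\<lambda>i. label (Z i \<omega>)) k (x :: real ^ 'p) / b - 1)\<^sup>2 \<le> 2 * H / (real N * b)"
    and B: "\<And>k \<omega>. k \<in> {1..K} \<Longrightarrow> \<omega> \<in> space M - E k \<Longrightarrow>
      (\<Sum>i\<in>I \<omega> k. resid (Z i \<omega>))\<^sup>2 \<le> real fold_size * (s / b) * H"
    and A: "\<And>k \<omega>. k \<in> {1..K} \<Longrightarrow> \<omega> \<in> space M - E k \<Longrightarrow>
      norm2 P X (\<lambda>x. m_hat L N (I \<omega>) (\<lambda>i. Z i \<omega>) k x - \<mu> x) \<le> ereal \<delta> \<Longrightarrow>
      (\<Sum>i\<in>I \<omega> k. ipw_error (\<lambda>x. m_hat L N (I \<omega>) (\<lambda>i. Z i \<omega>) k x - \<mu> x) (Z i \<omega>))\<^sup>2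
        \<le> real fold_size * (\<delta>\<^sup>2 / b) * H"
    and C: "\<And>k \<omega>. k \<in> {1..K} \<Longrightarrow> \<omega> \<in> space M - E k \<Longrightarrow>
      norm2 P X (\<lambda>x. m_hat L N (I \<omega>) (\<lambda>i. Z i \<omega>) k x - \<mu> x) \<le> ereal \<delta> \<Longrightarrow>
      (\<Sum>i\<in>I \<omega> k. \<bar>label (Z i \<omega>) * (m_hat L N (I \<omega>) (\<lambda>i. Z i \<omega>) k (covariate (Z i \<omega>))
        - \<mu> (covariate (Z i \<omega>)))\<bar>) \<le> real fold_size * (b * \<delta>) * H"
    by (elim exE) (rule that, (drule (1) bspec, elim conjE, (drule (1) bspec)?, (elim conjE)?, (erule allE)?, blast)+)
  let ?E = "\<Union>k\<in>{1..K}. E k"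
  have "prob ?E \<le> (\<Sum>k\<in>{1..K}. prob (E k))"
    using E(1) by (intro finite_measure_subadditive_finite) auto
  also have "\<dots> \<le> (\<Sum>k\<in>{1..K}. 4 / H)" by (intro sum_mono E(2))
  finally have pE: "prob ?E \<le> real K * (4 / H)" by simp
  have "?E \<in> events" using E(1) by auto
  moreover have "\<bar>theta_DRSS K N (I \<omega>) (m_hat L N (I \<omega>) (\<lambda>i. Z i \<omega>)) (pi_hat N (I \<omega>) (\<lambda>i. Rs i \<omega>))
        (\<lambda>i. Rs i \<omega>) (\<lambda>i. Ys i \<omega>) (\<lambda>i. Xs i \<omega>) - \<theta>
      - (1 / real N) * (\<Sum>i=1..N. psi_mu \<mu> b \<theta> (Rs i \<omega>) (Ys i \<omega>) (Xs i \<omega>) + IF_pi b \<Delta> (Rs i \<omega>))\<bar>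
    \<le> real K * (W * (\<delta> * (1 + 4 * H) + 4 * W * (sqrt s + \<bar>\<Delta>\<bar>)))"
    if w: "\<omega> \<in> space M - ?E"
      and norm: "\<forall>k\<in>{1..K}. norm2 P X (\<lambda>x. m_hat L N (I \<omega>) (\<lambda>i. Z i \<omega>) k x - \<mu> x) \<le> ereal \<delta>" for \<omega>
  proof -
    have ws: "\<omega> \<in> space M" and wk: "\<And>k. k \<in> {1..K} \<Longrightarrow> \<omega> \<in> space M - E k" using w by auto
    note J = folds_disjoint[OF ws] folds_cover[OF ws]
    define p where "p k = pi_hat N (I \<omega>) (\<lambda>i. Rs i \<omega>) k (0 :: real ^ 'p)" for k
    have q: "(p k / b - 1)\<^sup>2 \<le> 2 * H / (real N * b)" if "k \<in> {1..K}" for k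
      using q[OF that wk[OF that]] by (simp add: p_def Z)
    \<comment> \<open>Off the exceptional event every training set contains labels, so the default
      value of division by zero never enters the algebraic identity.\<close>
    have p_pos: "0 < p k" if "k \<in> {1..K}" for k
    proof -
      have "(p k / b - 1)\<^sup>2 \<le> (1/2)\<^sup>2"
        using order_trans[OF q[OF that] small] by (simp add: power_divide)
      then have "\<bar>p k / b - 1\<bar> \<le> 1/2" using power2_le_iff_abs_le[of "1/2" "p k / b - 1"] by simp
      then have "0 < p k / b" by linarith
      then show ?thesis using b_pos by (simp add: zero_less_divide_iff)
    qed
    let ?A = "\<lambda>k. \<Sum>i\<in>I \<omega> k. (m_hat L N (I \<omega>) (\<lambda>i. Z i \<omega>) k (Xs i \<omega>) - \<mu> (Xs i \<omega>)) * (1 - Rs i \<omega> / b)"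
    let ?C = "\<lambda>k. \<Sum>i\<in>I \<omega> k. Rs i \<omega> * (m_hat L N (I \<omega>) (\<lambda>i. Z i \<omega>) k (Xs i \<omega>) - \<mu> (Xs i \<omega>))"
    let ?B = "\<lambda>k. \<Sum>i\<in>I \<omega> k. (Rs i \<omega> * Ys i \<omega> - Rs i \<omega> * \<mu> (Xs i \<omega>)) / b + \<Delta>"
    let ?T = "\<lambda>k. ?A k - (b / p k - 1) / b * ?C k + (b / p k - 1) * ?B k
        - \<Delta> * (real fold_size * ((b / p k - 1) + (p k / b - 1)))"
    let ?bound = "W * (\<delta> * (1 + 4 * H) + 4 * W * (sqrt s + \<bar>\<Delta>\<bar>))"
    have eq: "theta_DRSS K N (I \<omega>) (m_hat L N (I \<omega>) (\<lambda>i. Z i \<omega>)) (pi_hat N (I \<omega>) (\<lambda>i. Rs i \<omega>))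
        (\<lambda>i. Rs i \<omega>) (\<lambda>i. Ys i \<omega>) (\<lambda>i. Xs i \<omega>) - \<theta>
      - (1 / real N) * (\<Sum>i=1..N. psi_mu \<mu> b \<theta> (Rs i \<omega>) (Ys i \<omega>) (Xs i \<omega>) + IF_pi b \<Delta> (Rs i \<omega>))
      = (1 / real N) * (\<Sum>k=1..K. ?T k)"
      by (rule DRSS_remainder_eq[OF J _ fold_size(1,2) K_ge_2 b_pos _ p_pos])
         (use folds_equal_size[OF ws] in \<open>auto simp: fold_size_def p_def pi_hat_def\<close>)
    \<comment> \<open>Each fold is charged with the whole sample size rather than its own, which
      costs the factor \<open>K\<close>, a constant.\<close>
    have "\<bar>(1 / real N) * (\<Sum>k=1..K. ?T k)\<bar> \<le> (1 / real N) * (\<Sum>k=1..K. real N * ?bound)"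
      unfolding abs_mult
    proof (intro mult_mono order_trans[OF sum_abs] sum_mono)
      fix k assume k: "k \<in> {1..K}"
      note n = norm[rule_format, OF k]
      show "\<bar>?T k\<bar> \<le> real N * ?bound"
      proof (rule DRSS_fold_remainder_le[OF b_pos _ _ _ _ _ _ _ _ small _ _ _ W])
        show "(p k / b - 1)\<^sup>2 \<le> 2 * H / (real N * b)" by (rule q[OF k])
        show "(?A k)\<^sup>2 \<le> real fold_size * (\<delta>\<^sup>2 / b) * H"
          using A[OF k wk[OF k] n] by (simp add: Z ipw_error_def)
        show "(?B k)\<^sup>2 \<le> real fold_size * (s / b) * H"
          using B[OF k wk[OF k]] by (simp add: Z resid_def)
        show "\<bar>?C k\<bar> \<le> real fold_size * (b * \<delta>) * H"
          using C[OF k wk[OF k] n] by (intro order_trans[OF sum_abs]) (simp add: Z)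
      qed (use b_pos fold_size(4) N_pos assms in auto)
    qed auto
    also have "\<dots> = real K * ?bound" using N_pos by simp
    finally show ?thesis unfolding eq .
  qed
  ultimately show ?thesis
    using pE by (intro bexI[of _ ?E] conjI ballI impI) auto
qed

end

subsection \<open>The expansion\<close>

lemma eventually_large_samples:
  "eventually Q (large_samples K) \<longleftrightarrow> (\<forall>\<^sub>F N in at_top. N \<in> sample_sizes K \<longrightarrow> Q N)"
  unfolding large_samples_def by (rule eventually_inf_principal)

text \<open>The weighted identity is guarded by \<open>pi_bar P R N > 0\<close>: with vanishing
  labelling probability the weight is \<open>0 / 0 = 0\<close>, whereas the unweighted expectation
  equals 1. By \<open>N_pi_bar\<close> the guard holds eventually.\<close>

theorem theoremB1:
  fixes P :: "'u measure" and R :: "nat \<Rightarrow> 'u \<Rightarrow> real" and Y :: "'u \<Rightarrow> real"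
    and X :: "'u \<Rightarrow> real ^ 'p"
    and m \<mu> :: "real ^ 'p \<Rightarrow> real" and \<pi> :: "nat \<Rightarrow> real ^ 'p \<Rightarrow> real"
    and sigma1_sq sigma2_sq \<theta>0 :: real
    and K :: nat and M :: "nat \<Rightarrow> 'w measure"
    and Rs Ys :: "nat \<Rightarrow> nat \<Rightarrow> 'w \<Rightarrow> real" and Xs :: "nat \<Rightarrow> nat \<Rightarrow> 'w \<Rightarrow> real ^ 'p"
    and I :: "nat \<Rightarrow> 'w \<Rightarrow> nat \<Rightarrow> nat set"
    and L :: "nat \<Rightarrow> 'p learner"
    and mh ph :: "nat \<Rightarrow> 'w \<Rightarrow> nat \<Rightarrow> real ^ 'p \<Rightarrow> real"
    and \<Psi> :: "nat \<Rightarrow> real \<Rightarrow> real \<Rightarrow> real ^ 'p \<Rightarrow> real"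
  assumes basic: "basic_assumption P R Y X m \<mu> sigma1_sq sigma2_sq"
    and m: "is_regression P X Y m"
    and mu: "\<mu> \<in> borel_measurable borel"
    and propensity: "\<And>N. is_propensity P X (R N) (\<pi> N)"
    and theta0: "\<theta>0 = (LINT u|P. Y u)"
    and K: "K \<ge> 2"
    and sample: "\<And>N. N \<in> sample_sizes K \<Longrightarrow>
      crossfit_sample (M N) P (\<lambda>u. observe (R N u) (Y u) (X u)) N K
        (\<lambda>i \<omega>. observe (Rs N i \<omega>) (Ys N i \<omega>) (Xs N i \<omega>)) (I N)"
    and learner: "\<And>N. N \<in> sample_sizes K \<Longrightarrow> measurable_learner N (L N)"
    and mh: "\<And>N \<omega> k. mh N \<omega> k =
      m_hat (L N) N (I N \<omega>) (\<lambda>i. observe (Rs N i \<omega>) (Ys N i \<omega>) (Xs N i \<omega>)) k"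
    and ph: "\<And>N \<omega> k. ph N \<omega> k = pi_hat N (I N \<omega>) (\<lambda>i. Rs N i \<omega>) k"
    and Psi: "\<And>N r y x. \<Psi> N r y x =
      psi_mu \<mu> (pi_bar P R N) \<theta>0 r y x + IF_pi (pi_bar P R N) (Delta_mu P X m \<mu>) r"
    and MCAR: "\<And>N. AE u in P. \<pi> N (X u) = pi_bar P R N"
    and N_pi_bar: "filterlim (\<lambda>N. real N * pi_bar P R N) at_top (large_samples K)"
    and m_mu_finite: "norm2 P X (\<lambda>x. m x - \<mu> x) < \<infinity>"
    and m_hat_mu: "\<And>k. k \<in> {1..K} \<Longrightarrow>
      smallo_p (large_samples K) M (\<lambda>N \<omega>. norm2 P X (\<lambda>x. mh N \<omega> k x - \<mu> x)) (\<lambda>_. 1)"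
  shows "(\<forall>N. a_seq P X \<pi> N = pi_bar P R N) \<and>
    (\<forall>k\<in>{1..K}.
      (\<forall>N\<in>sample_sizes K. pi_bar P R N > 0 \<longrightarrow> (\<forall>\<omega>\<in>space (M N).
         E_X P X (\<lambda>x. a_seq P X \<pi> N / \<pi> N x * (1 - \<pi> N x / ph N \<omega> k x)\<^sup>2) =
         E_X P X (\<lambda>x. (1 - \<pi> N x / ph N \<omega> k x)\<^sup>2))) \<and>
      bigO_p (large_samples K) M
        (\<lambda>N \<omega>. ereal (E_X P X (\<lambda>x. (1 - \<pi> N x / ph N \<omega> k x)\<^sup>2)))
        (\<lambda>N. 1 / (real N * pi_bar P R N))) \<and>
    smallo_p (large_samples K) M
      (\<lambda>N \<omega>. ereal (
         theta_DRSS K N (I N \<omega>) (mh N \<omega>) (ph N \<omega>)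
           (\<lambda>i. Rs N i \<omega>) (\<lambda>i. Ys N i \<omega>) (\<lambda>i. Xs N i \<omega>) - \<theta>0
         - (1 / real N) * (\<Sum>i=1..N. \<Psi> N (Rs N i \<omega>) (Ys N i \<omega>) (Xs N i \<omega>))))
      (\<lambda>N. (real N * a_seq P X \<pi> N) powr (-1/2))"
proof -
  interpret Pop: basic_assumption P R Y X m \<mu> sigma1_sq sigma2_sq by (rule basic)
  note [measurable] = Pop.X_measurable
  let ?F = "large_samples K" and ?b = "pi_bar P R"
  define Zs where "Zs N i \<omega> = observe (Rs N i \<omega>) (Ys N i \<omega>) (Xs N i \<omega>)" for N i \<omega>
  \<comment> \<open>The summand 1 makes \<open>s\<close> strictly positive; \<open>s\<close> does
    not depend on \<open>N\<close>.\<close>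
  define s where "s = (LINT u|P. (Y u - \<mu> (X u))\<^sup>2) + 1"
  define V where "V N \<omega> = theta_DRSS K N (I N \<omega>) (mh N \<omega>) (ph N \<omega>)
      (\<lambda>i. Rs N i \<omega>) (\<lambda>i. Ys N i \<omega>) (\<lambda>i. Xs N i \<omega>) - \<theta>0
    - (1 / real N) * (\<Sum>i=1..N. \<Psi> N (Rs N i \<omega>) (Ys N i \<omega>) (Xs N i \<omega>))" for N \<omega>
  have pi_meas [measurable]: "\<pi> N \<in> borel_measurable borel" for N
    using propensity[of N] by (simp add: is_propensity_def is_regression_def)
  have mcar: "AE u in P. cond_E P X (\<lambda>u. indicator {1} (R N u)) u = ?b N" for N
    using propensity[of N] MCAR[of N] unfolding is_propensity_def is_regression_def by auto
  have crossfit: "mcar_crossfit P R Y X m \<mu> sigma1_sq sigma2_sq (M N) N K (Zs N) (I N) (L N) (?b N)"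
    if "N \<in> sample_sizes K" "0 < ?b N" for N
    using that basic sample[OF that(1)] mcar K m mu learner[OF that(1)] unfolding Zs_def
    by (intro mcar_crossfit.intro mcar_crossfit_axioms.intro) (auto simp: sample_sizes_def)
  have mh': "mh N \<omega> = m_hat (L N) N (I N \<omega>) (\<lambda>i. Zs N i \<omega>)" for N \<omega>
    by (rule ext) (simp add: mh Zs_def)
  have ph': "ph N \<omega> = pi_hat N (I N \<omega>) (\<lambda>i. Rs N i \<omega>)" for N \<omega>
    by (rule ext) (simp add: ph)
  have ph_label: "ph N \<omega> k x = pi_hat N (I N \<omega>) (\<lambda>i. label (Zs N i \<omega>)) k (0 :: real ^ 'p)" for N \<omega> k x
    by (simp add: ph Zs_def pi_hat_def)

  have sizes: "\<forall>\<^sub>F N in ?F. N \<in> sample_sizes K"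
    by (simp add: eventually_large_samples)
  have rate: "\<forall>\<^sub>F N in ?F. c < real N * ?b N" for c
    using N_pi_bar by (simp add: filterlim_at_top_dense)
  have pos: "0 < ?b N" if "0 < real N * ?b N" for N
    using that by (simp add: zero_less_mult_iff)

  have a_seq: "a_seq P X \<pi> N = ?b N" for N
  proof -
    have "(LINT u|P. inverse (\<pi> N (X u))) = (LINT u|P. inverse (?b N))"
      by (rule integral_cong_AE) (use MCAR[of N] in auto)
    then show ?thesis by (simp add: a_seq_def E_X_def Pop.prob_space)
  qed
  \<comment> \<open>Both propensities are constant in the covariate, the true one almost everywhere,
    so the expectation collapses to a number depending on the sample only.\<close>
  have E_X_eq: "E_X P X (\<lambda>x. c * (1 - \<pi> N x / ph N \<omega> k x)\<^sup>2) = c * (1 - ?b N / ph N \<omega> k 0)\<^sup>2" for N \<omega> k c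
  proof -
    have "(LINT u|P. c * (1 - \<pi> N (X u) / ph N \<omega> k (X u))\<^sup>2) = (LINT u|P. c * (1 - ?b N / ph N \<omega> k 0)\<^sup>2)"
      unfolding ph_label
    proof (rule integral_cong_AE)
      show "AE u in P. c * (1 - \<pi> N (X u) / pi_hat N (I N \<omega>) (\<lambda>i. label (Zs N i \<omega>)) k (0 :: real ^ 'p))\<^sup>2
          = c * (1 - ?b N / pi_hat N (I N \<omega>) (\<lambda>i. label (Zs N i \<omega>)) k (0 :: real ^ 'p))\<^sup>2"
        using MCAR[of N] by eventually_elim simp
    qed auto
    then show ?thesis by (simp add: E_X_def Pop.prob_space)
  qed

  have weighted: "E_X P X (\<lambda>x. a_seq P X \<pi> N / \<pi> N x * (1 - \<pi> N x / ph N \<omega> k x)\<^sup>2)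
      = E_X P X (\<lambda>x. (1 - \<pi> N x / ph N \<omega> k x)\<^sup>2)" if "0 < ?b N" for N \<omega> k
    unfolding E_X_def a_seq ph_label
  proof (rule integral_cong_AE)
    show "AE u in P. ?b N / \<pi> N (X u) * (1 - \<pi> N (X u) / pi_hat N (I N \<omega>) (\<lambda>i. label (Zs N i \<omega>)) k (0 :: real ^ 'p))\<^sup>2
        = (1 - \<pi> N (X u) / pi_hat N (I N \<omega>) (\<lambda>i. label (Zs N i \<omega>)) k (0 :: real ^ 'p))\<^sup>2"
      using MCAR[of N] by eventually_elim (use that in simp)
  qed auto

  have bigO: "bigO_p ?F M (\<lambda>N \<omega>. ereal (E_X P X (\<lambda>x. (1 - \<pi> N x / ph N \<omega> k x)\<^sup>2)))
      (\<lambda>N. 1 / (real N * ?b N))" if k: "k \<in> {1..K}" for k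
    unfolding bigO_p_def E_X_eq[of 1, simplified]
  proof (intro conjI allI impI)
    show "\<forall>\<^sub>F N in ?F. (\<lambda>\<omega>. ereal ((1 - ?b N / ph N \<omega> k 0)\<^sup>2)) \<in> borel_measurable (M N)"
      using sizes rate[of 0]
    proof eventually_elim
      case (elim N)
      interpret mcar_crossfit P R Y X m \<mu> sigma1_sq sigma2_sq "M N" N K "Zs N" "I N" "L N" "?b N"
        using elim pos by (intro crossfit) auto
      show ?case
        unfolding ph_label using pi_hat_measurable[OF k] by measurable
    qed
    fix \<epsilon> :: real assume "0 < \<epsilon>"
    \<comment> \<open>This makes \<open>1 / H\<close> equal to half of \<open>\<epsilon>\<close>,
      hence strictly smaller.\<close>
    define H where "H = 2 / \<epsilon>"
    have H: "0 < H" "1 / H < \<epsilon>" using \<open>0 < \<epsilon>\<close> by (auto simp: H_def)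
    show "\<exists>C. \<forall>\<^sub>F N in ?F. measure (M N) {\<omega> \<in> space (M N).
        \<bar>ereal ((1 - ?b N / ph N \<omega> k 0)\<^sup>2)\<bar> > ereal (C * (1 / (real N * ?b N)))} < \<epsilon>"
      \<comment> \<open>Beyond this threshold \<open>2 * H / (N * b)\<close> is at most 1/4, so the
        relative error is at most 1/2. The inversion then doubles the error, and its square gives
        \<open>4 * 2 * H\<close>, the witness \<open>8 * H\<close>.\<close>
      using sizes rate[of "8 * H"]
    proof (intro exI[of _ "8 * H"], eventually_elim)
      case (elim N)
      have lam: "0 < real N * ?b N" using elim H by linarith
      interpret mcar_crossfit P R Y X m \<mu> sigma1_sq sigma2_sq "M N" N K "Zs N" "I N" "L N" "?b N"
        using elim pos lam by (intro crossfit) auto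
      obtain E where E: "E \<in> events" "prob E \<le> 1 / H" and q: "\<And>\<omega> (x :: real ^ 'p). \<omega> \<in> space (M N) - E \<Longrightarrow>
          (pi_hat N (I N \<omega>) (\<lambda>i. label (Zs N i \<omega>)) k x / ?b N - 1)\<^sup>2 \<le> 2 * H / (real N * ?b N)"
        using prob_propensity_error[OF k H(1)] by auto
      have "(1 - ?b N / ph N \<omega> k 0)\<^sup>2 \<le> 8 * H * (1 / (real N * ?b N))" if w: "\<omega> \<in> space (M N) - E" for \<omega>
      proof -
        let ?q = "ph N \<omega> k 0 / ?b N - 1"
        have q: "?q\<^sup>2 \<le> 2 * H / (real N * ?b N)" using q[OF w] by (simp add: ph_label)
        also have "\<dots> \<le> (1/2)\<^sup>2" using elim lam by (simp add: field_simps power2_eq_square)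
        finally have "\<bar>?q\<bar> \<le> 1/2" using power2_le_iff_abs_le[of "1/2" ?q] by simp
        then have "\<bar>?b N / ph N \<omega> k 0 - 1\<bar> \<le> 2 * \<bar>?q\<bar>"
          using b_pos by (intro inverse_ratio_bounds(1)) auto
        from power_mono[OF this abs_ge_zero, of 2] have "(?b N / ph N \<omega> k 0 - 1)\<^sup>2 \<le> (2 * \<bar>?q\<bar>)\<^sup>2"
          by (simp only: power2_abs)
        also have "\<dots> \<le> 8 * H * (1 / (real N * ?b N))"
          using q by (simp add: power_mult_distrib)
        finally show ?thesis by (simp add: power2_commute)
      qed
      then have "{\<omega> \<in> space (M N). \<bar>ereal ((1 - ?b N / ph N \<omega> k 0)\<^sup>2)\<bar> > ereal (8 * H * (1 / (real N * ?b N)))} \<subseteq> E"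
        by (auto simp: not_le[symmetric])
      then have "prob {\<omega> \<in> space (M N). \<bar>ereal ((1 - ?b N / ph N \<omega> k 0)\<^sup>2)\<bar> > ereal (8 * H * (1 / (real N * ?b N)))} \<le> prob E"
        using E(1) by (rule finite_measure_mono)
      then show ?case using E(2) H(2) by linarith
    qed
  qed

  have V_eq: "V N \<omega> = theta_DRSS K N (I N \<omega>) (m_hat (L N) N (I N \<omega>) (\<lambda>i. Zs N i \<omega>)) (pi_hat N (I N \<omega>) (\<lambda>i. Rs N i \<omega>))
        (\<lambda>i. Rs N i \<omega>) (\<lambda>i. Ys N i \<omega>) (\<lambda>i. Xs N i \<omega>) - \<theta>0
      - (1 / real N) * (\<Sum>i=1..N. psi_mu \<mu> (?b N) \<theta>0 (Rs N i \<omega>) (Ys N i \<omega>) (Xs N i \<omega>)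
          + IF_pi (?b N) (Delta_mu P X m \<mu>) (Rs N i \<omega>))" for N \<omega>
    unfolding V_def mh' ph' Psi ..

  have smallo: "smallo_p ?F M (\<lambda>N \<omega>. ereal (V N \<omega>)) (\<lambda>N. (real N * a_seq P X \<pi> N) powr (-1/2))"
    unfolding smallo_p_def a_seq
  proof (intro conjI allI impI)
    show "\<forall>\<^sub>F N in ?F. (\<lambda>\<omega>. ereal (V N \<omega>)) \<in> borel_measurable (M N)"
      using sizes rate[of 0]
    proof eventually_elim
      case (elim N)
      interpret mcar_crossfit P R Y X m \<mu> sigma1_sq sigma2_sq "M N" N K "Zs N" "I N" "L N" "?b N"
        using elim pos by (intro crossfit) auto
      have "V N \<in> borel_measurable (M N)"
        unfolding V_eq[abs_def] by (rule DRSS_remainder_measurable) (rule Zs_def)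
      then show ?case by measurable
    qed
    fix \<epsilon> :: real assume "0 < \<epsilon>"
    show "((\<lambda>N. measure (M N) {\<omega> \<in> space (M N). \<bar>ereal (V N \<omega>)\<bar> > ereal (\<epsilon> * (real N * ?b N) powr (-1/2))}) \<longlongrightarrow> 0) ?F"
    proof (rule tendstoI)
      fix \<eta> :: real assume "0 < \<eta>"
      \<comment> \<open>The constants are fixed in this order: \<open>H\<close> makes the
        exceptional probability \<open>real K * (4 / H)\<close> equal to \<open>\<eta> / 2\<close>;
        then \<open>\<delta>\<close> makes the part of the bound due to the fit equal to half of the
        permitted error; only then is \<open>N\<close> taken large.\<close>
      define H where "H = 8 * real K / \<eta>"
      define \<delta> where "\<delta> = \<epsilon> / (2 * (real K * sqrt H * (1 + 4 * H)))"
      define t where "t = sqrt s + \<bar>Delta_mu P X m \<mu>\<bar>"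
      have H: "0 < H" using \<open>0 < \<eta>\<close> K by (simp add: H_def)
      have \<delta>: "0 < \<delta>" using \<open>0 < \<epsilon>\<close> K H by (simp add: \<delta>_def)
      have s: "0 < s" "0 \<le> t" by (auto simp: s_def t_def intro: add_nonneg_pos)
      define n where "n k N \<omega> = norm2 P X (\<lambda>x. mh N \<omega> k x - \<mu> x)" for k N \<omega>
      have n: "\<forall>\<^sub>F N in ?F. n k N \<in> borel_measurable (M N)"
        "\<forall>\<^sub>F N in ?F. measure (M N) {\<omega> \<in> space (M N). \<bar>n k N \<omega>\<bar> > ereal \<delta>} < \<eta> / (2 * real K)"
        if "k \<in> {1..K}" for k
      proof -
        show "\<forall>\<^sub>F N in ?F. n k N \<in> borel_measurable (M N)"
          using m_hat_mu[OF that] by (simp add: smallo_p_def n_def[abs_def])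
        have "((\<lambda>N. measure (M N) {\<omega> \<in> space (M N). \<bar>n k N \<omega>\<bar> > ereal \<delta>}) \<longlongrightarrow> 0) ?F"
          using m_hat_mu[OF that] \<delta> by (simp add: smallo_p_def n_def)
        then show "\<forall>\<^sub>F N in ?F. measure (M N) {\<omega> \<in> space (M N). \<bar>n k N \<omega>\<bar> > ereal \<delta>} < \<eta> / (2 * real K)"
          using \<open>0 < \<eta>\<close> K by (intro order_tendstoD(2)[of _ 0]) auto
      qed
      have "\<forall>\<^sub>F N in ?F. \<forall>k\<in>{1..K}. n k N \<in> borel_measurable (M N)"
        "\<forall>\<^sub>F N in ?F. \<forall>k\<in>{1..K}. measure (M N) {\<omega> \<in> space (M N). \<bar>n k N \<omega>\<bar> > ereal \<delta>} < \<eta> / (2 * real K)"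
        using n by (auto intro!: eventually_ball_finite)
      \<comment> \<open>The first threshold keeps the relative propensity error below 1/2; the
        second brings the part of the bound with the additional factor \<open>W\<close> under the
        other half of the permitted error.\<close>
      with sizes rate[of "8 * H"] rate[of "(8 * t * real K * H / \<epsilon>)\<^sup>2"]
      show "\<forall>\<^sub>F N in ?F. dist (measure (M N) {\<omega> \<in> space (M N).
          \<bar>ereal (V N \<omega>)\<bar> > ereal (\<epsilon> * (real N * ?b N) powr (-1/2))}) 0 < \<eta>"
      proof eventually_elim
        case (elim N)
        let ?lam = "real N * ?b N"
        have lam: "0 < ?lam" using elim H by linarith
        interpret mcar_crossfit P R Y X m \<mu> sigma1_sq sigma2_sq "M N" N K "Zs N" "I N" "L N" "?b N"
          using elim pos lam by (intro crossfit) auto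
        let ?W = "sqrt (H / ?lam)"
        have "2 * H / ?lam \<le> 1 / 4" using elim lam by (simp add: field_simps)
        moreover have "resid_var \<le> s" by (simp add: resid_var_def s_def)
        ultimately have "\<exists>E\<in>events. prob E \<le> real K * (4 / H) \<and> (\<forall>\<omega>\<in>space (M N) - E.
            (\<forall>k\<in>{1..K}. n k N \<omega> \<le> ereal \<delta>) \<longrightarrow>
            \<bar>V N \<omega>\<bar> \<le> real K * (?W * (\<delta> * (1 + 4 * H) + 4 * ?W * t)))"
          unfolding V_eq mh' n_def t_def
          by (intro prob_DRSS_remainder[OF Zs_def H \<delta> _ s(1) _ refl])
        then obtain E where E: "E \<in> events" "prob E \<le> real K * (4 / H)" and bound: "\<And>\<omega>. \<omega> \<in> space (M N) - E \<Longrightarrow>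
            (\<forall>k\<in>{1..K}. n k N \<omega> \<le> ereal \<delta>) \<Longrightarrow> \<bar>V N \<omega>\<bar> \<le> real K * (?W * (\<delta> * (1 + 4 * H) + 4 * ?W * t))"
          by blast
        define S where "S = sqrt ?lam"
        have S: "0 < S" using lam by (simp add: S_def)
        have r: "?lam powr (-1/2) = 1 / S"
          using lam powr_minus_divide[of ?lam "1/2"] powr_half_sqrt[of ?lam] by (simp add: S_def)
        have W: "?W = sqrt H * ?lam powr (-1/2)"
          unfolding r S_def real_sqrt_divide by simp
        have "8 * t * real K * H / \<epsilon> \<le> S"
          using elim unfolding S_def by (intro real_le_rsqrt) simp
        then have "8 * t * real K * H \<le> S * \<epsilon>"
          using \<open>0 < \<epsilon>\<close> by (simp only: pos_divide_le_eq)
        then have "8 * t * real K * H * ?lam powr (-1/2) \<le> \<epsilon>"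
          using S unfolding r by (simp add: pos_divide_le_eq mult.commute)
        moreover have "real K * sqrt H * (\<delta> * (1 + 4 * H)) = \<epsilon> / 2"
        proof -
          have "x * (\<epsilon> / (2 * x)) = \<epsilon> / 2" if "x \<noteq> 0" for x using that by simp
          from this[of "real K * sqrt H * (1 + 4 * H)", folded \<delta>_def]
          show ?thesis using K H by (simp add: mult_ac)
        qed
        moreover have "real K * sqrt H * (4 * ?W * t) = (8 * t * real K * H * ?lam powr (-1/2)) / 2"
          unfolding W using H by (simp add: field_simps)
        ultimately have "real K * sqrt H * (\<delta> * (1 + 4 * H) + 4 * ?W * t) \<le> \<epsilon>"
          unfolding distrib_left by linarith
        from mult_right_mono[OF this, of "?lam powr (-1/2)"]
        have "real K * (?W * (\<delta> * (1 + 4 * H) + 4 * ?W * t)) \<le> \<epsilon> * ?lam powr (-1/2)"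
          by (simp add: W mult_ac)
        then have small: "\<bar>V N \<omega>\<bar> \<le> \<epsilon> * ?lam powr (-1/2)"
          if "\<omega> \<in> space (M N) - E" "\<forall>k\<in>{1..K}. n k N \<omega> \<le> ereal \<delta>" for \<omega>
          using bound[OF that] by linarith
        let ?n = "\<lambda>k. {\<omega> \<in> space (M N). \<bar>n k N \<omega>\<bar> > ereal \<delta>}"
        have n_events: "?n k \<in> events" if "k \<in> {1..K}" for k
        proof -
          have [measurable]: "n k N \<in> borel_measurable (M N)" using elim that by blast
          show ?thesis by measurable
        qed
        \<comment> \<open>A large remainder forces either the exceptional event, of probability at
          most \<open>\<eta> / 2\<close>, or a bad fit on some fold; the latter events have total
          probability below \<open>\<eta> / 2\<close>. An infinite norm counts as a bad fit.\<close>
        have "{\<omega> \<in> space (M N). \<bar>ereal (V N \<omega>)\<bar> > ereal (\<epsilon> * ?lam powr (-1/2))} \<subseteq> E \<union> (\<Union>k\<in>{1..K}. ?n k)"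
        proof (rule subsetI, rule ccontr)
          fix \<omega> assume V: "\<omega> \<in> {\<omega> \<in> space (M N). \<bar>ereal (V N \<omega>)\<bar> > ereal (\<epsilon> * ?lam powr (-1/2))}"
            and o: "\<omega> \<notin> E \<union> (\<Union>k\<in>{1..K}. ?n k)"
          have "n k N \<omega> \<le> ereal \<delta>" if "k \<in> {1..K}" for k
          proof -
            have "\<not> \<bar>n k N \<omega>\<bar> > ereal \<delta>" using V o that by blast
            then show ?thesis using abs_ereal_ge0 by (cases "n k N \<omega>") auto
          qed
          then show False using small[of \<omega>] V o by auto
        qed
        then have "prob {\<omega> \<in> space (M N). \<bar>ereal (V N \<omega>)\<bar> > ereal (\<epsilon> * ?lam powr (-1/2))}
            \<le> prob (E \<union> (\<Union>k\<in>{1..K}. ?n k))"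
          using E(1) n_events by (intro finite_measure_mono) auto
        also have "\<dots> \<le> prob E + prob (\<Union>k\<in>{1..K}. ?n k)"
          using E(1) n_events by (intro measure_Un_le) auto
        also have "prob (\<Union>k\<in>{1..K}. ?n k) \<le> (\<Sum>k\<in>{1..K}. prob (?n k))"
          using n_events by (intro finite_measure_subadditive_finite) auto
        also have "(\<Sum>k\<in>{1..K}. prob (?n k)) < (\<Sum>k\<in>{1..K}. \<eta> / (2 * real K))"
          using elim K by (intro sum_strict_mono) auto
        also have "\<dots> = \<eta> / 2" using K by simp
        finally show ?case
          using E(2) \<open>0 < \<eta>\<close> K by (simp add: H_def)
      qed
    qed
  qed
  show ?thesis
    using a_seq weighted bigO smallo unfolding V_def by blast
qed

end
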